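(* Let $\ell,d\in\mathbb{N}$ and let $\mathcal{A}\colon \Sigma_\ell \to \mathrm{GL}_d(\mathbb{R})$ be a locally constant cocycle generated by $(A_1,\ldots,A_\ell)\in \mathrm{GL}_d(\mathbb{R})^\ell$. Suppose that $\mathcal{A}^t$ is irreducible for every positive integer $t$ dividing $d$, and that $\mathcal{A}^{\wedge m}$ is irreducible for every $1\le m\le d-1$. Then there exists $k\in\mathbb{N}$ such that $\mathcal{A}$ is $k$-quasi-multiplicative.
   Context: $\Sigma_\ell=\{1,\ldots,\ell\}^{\mathbb{N}}$ is the one-sided full shift on $\ell$ symbols with left shift $\sigma$. A locally constant cocycle generated by $(A_1,\ldots,A_\ell)\in \mathrm{GL}_d(\mathbb{R})^\ell$ is the map $\mathcal{A}\colon\Sigma_\ell\to \mathrm{GL}_d(\mathbb{R})$, $\mathcal{A}(x)=A_{x_0}$, depending only on the zeroth symbol $x_0$ of $x$. $\mathcal{L}(n)$ is the set of words of length $n$ over $\{1,\ldots,\ell\}$, and $\mathcal{L}=\bigcup_{n\in\mathbb{N}}\mathcal{L}(n)$. For $I=i_0\ldots i_{n-1}\in\mathcal{L}(n)$ write $\mathcal{A}_I=A_{i_{n-1}}\cdots A_{i_0}$. Concatenation of words is written by juxtaposition, and $\|\cdot\|$ is the operator norm. The cocycle $\mathcal{A}$ (equivalently, a finite family of invertible linear maps of a finite-dimensional real vector space $E$, here $E=\mathbb{R}^d$) is irreducible if there is no nonzero proper subspace $V\subset E$ with $A_iV\subset V$ for all $i$. For $t\in\mathbb{N}$, $\mathcal{A}^t$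 is the cocycle $x\mapsto \mathcal{A}(\sigma^{t-1}x)\cdots\mathcal{A}(x)$ over $\sigma^t$, i.e. the one generated by the family $\{\mathcal{A}_I : I\in\mathcal{L}(t)\}$. For $1\le m\le d-1$, $\mathcal{A}^{\wedge m}$ is the exterior power cocycle, generated by the induced linear maps $A_1^{\wedge m},\ldots,A_\ell^{\wedge m}$ on $(\mathbb{R}^d)^{\wedge m}$. Irreducibility of these cocycles means irreducibility of the corresponding families on $\mathbb{R}^d$ and $(\mathbb{R}^d)^{\wedge m}$ respectively. $\mathcal{A}$ is $k$-quasi-multiplicative if there exists $c>0$ such that for all $I,J\in\mathcal{L}$ there exists $K=K(I,J)\in\mathcal{L}(k)$ with $\|\mathcal{A}_{IKJ}\|\ge c\|\mathcal{A}_I\|\|\mathcal{A}_J\|$. *)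

theory Defs
  imports "HOL-Analysis.Analysis"
begin

definition words :: "nat \<Rightarrow> nat \<Rightarrow> nat list set" where
  "words l n = {w. length w = n \<and> set w \<subseteq> {1..l}}"

definition language :: "nat \<Rightarrow> nat list set" where
  "language l = (\<Union>n. words l n)"

text \<open>The matrix of the first letter acts first: the word \<open>i\<^sub>0 \<dots> i\<^sub>n\<^sub>-\<^sub>1\<close> gives
  \<open>A i\<^sub>n\<^sub>-\<^sub>1 \<cdots> A i\<^sub>0\<close>.\<close>

primrec word_prod :: "(nat \<Rightarrow> real^'d^'d) \<Rightarrow> nat list \<Rightarrow> real^'d^'d" where
  "word_prod A [] = mat 1"
| "word_prod A (i # w) = word_prod A w ** A i"

definition quasi_multiplicative :: "nat \<Rightarrow> (nat \<Rightarrow> real^'d^'d) \<Rightarrow> nat \<Rightarrow> bool" where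
  "quasi_multiplicative l A k \<longleftrightarrow>
     (\<exists>c>0. \<forall>I\<in>language l. \<forall>J\<in>language l. \<exists>K\<in>words l k.
        onorm ((*v) (word_prod A (I @ K @ J)))
          \<ge> c * onorm ((*v) (word_prod A I)) * onorm ((*v) (word_prod A J)))"

definition irreducible_family :: "'v::real_vector set \<Rightarrow> ('v \<Rightarrow> 'v) set \<Rightarrow> bool" where
  "irreducible_family E F \<longleftrightarrow>
     \<not> (\<exists>V. subspace V \<and> V \<subseteq> E \<and> V \<noteq> {0} \<and> V \<noteq> E \<and> (\<forall>f\<in>F. f ` V \<subseteq> V))"

text \<open>
  The exterior algebra of \<open>real^'d\<close> is modelled on \<open>real^('d set)\<close>. The basis vector indexed by
  \<open>S = {s\<^sub>0, \<dots>, s\<^sub>m\<^sub>-\<^sub>1}\<close> stands for \<open>e s\<^sub>0 \<and> \<dots> \<and> e s\<^sub>m\<^sub>-\<^sub>1\<close>, where \<open>s\<^sub>i = from_nat_into S i\<close>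
  is a fixed enumeration of \<open>S\<close>; another enumeration only changes signs of basis vectors.
  The \<open>S\<close>-coordinate of \<open>v\<^sub>0 \<and> \<dots> \<and> v\<^sub>m\<^sub>-\<^sub>1\<close> is the \<open>m \<times> m\<close> minor of the matrix with rows
  \<open>v\<^sub>0, \<dots>, v\<^sub>m\<^sub>-\<^sub>1\<close> on the columns in \<open>S\<close>.
\<close>

definition wedge :: "nat \<Rightarrow> (nat \<Rightarrow> real^'d) \<Rightarrow> real^('d set)" where
  "wedge m v = (\<chi> S. if card S = m
     then \<Sum>p | p permutes {..<m}. of_int (sign p) * (\<Prod>i<m. v i $ from_nat_into S (p i))
     else 0)"

definition exterior_power :: "nat \<Rightarrow> (real^('d::finite set)) set" where
  "exterior_power m = span (range (wedge m))"

text \<open>The induced map is the linear extension of \<open>e s\<^sub>0 \<and> \<dots> \<and> e s\<^sub>m\<^sub>-\<^sub>1 \<mapsto> A e s\<^sub>0 \<and> \<dots> \<and> A e s\<^sub>m\<^sub>-\<^sub>1\<close>;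
  it is set to \<open>0\<close> on basis vectors of degree other than \<open>m\<close>. Lemma \<open>exterior_map_wedge\<close> below
  is its defining property.\<close>

definition exterior_map :: "nat \<Rightarrow> real^'d^'d \<Rightarrow> real^('d set) \<Rightarrow> real^('d set)" where
  "exterior_map m A x =
     (\<Sum>S | card S = m. x $ S *\<^sub>R wedge m (\<lambda>i. A *v axis (from_nat_into S i) 1))"

lemma wedge_nth:
  "wedge m v $ S = (if card S = m
     then \<Sum>p | p permutes {..<m}. of_int (sign p) * (\<Prod>i<m. v i $ from_nat_into S (p i))
     else 0)"
  by (simp add: wedge_def)

lemma wedge_cong: "(\<And>i. i < m \<Longrightarrow> v i = w i) \<Longrightarrow> wedge m v = wedge m w"
  by (auto simp: vec_eq_iff wedge_nth intro!: sum.cong prod.cong)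

lemma wedge_permute:
  fixes v :: "nat \<Rightarrow> real^'d"
  assumes q: "q permutes {..<m}"
  shows "wedge m (v \<circ> q) = of_int (sign q) *\<^sub>R wedge m v"
proof (rule vec_eq_iff[THEN iffD2], rule allI)
  fix S :: "'d set"
  let ?e = "from_nat_into S"
  let ?P = "{p. p permutes {..<m}}"
  have perm: "permutation p" if "p permutes {..<m}" for p
    using that by (auto intro: permutation_permutes[THEN iffD2])
  have "(\<Sum>p\<in>?P. of_int (sign p) * (\<Prod>i<m. v (q i) $ ?e (p i)))
      = (\<Sum>p\<in>?P. of_int (sign (p \<circ> q)) * (\<Prod>i<m. v (q i) $ ?e ((p \<circ> q) i)))"
    by (rule sum_permutations_compose_right[OF q])
  also have "\<dots> = (\<Sum>p\<in>?P. of_int (sign q) * (of_int (sign p) * (\<Prod>i<m. v i $ ?e (p i))))"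
  proof (rule sum.cong)
    fix p assume "p \<in> ?P"
    then have "sign (p \<circ> q) = sign p * sign q"
      using perm q by (simp add: sign_compose)
    moreover have "(\<Prod>i<m. v (q i) $ ?e ((p \<circ> q) i)) = (\<Prod>i<m. v i $ ?e (p i))"
      using prod.permute[OF q, of "\<lambda>i. v i $ ?e (p i)"] by (simp add: o_def)
    ultimately show "of_int (sign (p \<circ> q)) * (\<Prod>i<m. v (q i) $ ?e ((p \<circ> q) i))
        = of_int (sign q) * (of_int (sign p) * (\<Prod>i<m. v i $ ?e (p i)))"
      by (simp add: mult_ac)
  qed simp
  finally show "wedge m (v \<circ> q) $ S = (of_int (sign q) *\<^sub>R wedge m v) $ S"
    by (simp add: wedge_nth sum_distrib_left)
qed

lemma wedge_eq_0:
  fixes v :: "nat \<Rightarrow> real^'d"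
  assumes "i < m" "j < m" "i \<noteq> j" "v i = v j"
  shows "wedge m v = 0"
proof -
  have q: "Transposition.transpose i j permutes {..<m}"
    using assms by (intro permutes_swap_id) auto
  have "v \<circ> Transposition.transpose i j = v"
    using assms by (auto simp: fun_eq_iff Transposition.transpose_def)
  with wedge_permute[OF q, of v] have "wedge m v = - wedge m v"
    using assms by (simp add: sign_swap_id)
  then show ?thesis
    by (simp add: vec_eq_iff)
qed

lemma wedge_matrix_expand:
  fixes v :: "nat \<Rightarrow> real^'d" and A :: "real^'d^'d"
  shows "wedge m (\<lambda>i. A *v v i) =
    (\<Sum>f\<in>{..<m} \<rightarrow>\<^sub>E UNIV. (\<Prod>i<m. v i $ f i) *\<^sub>R wedge m (\<lambda>i. A *v axis (f i) 1))"
proof (rule vec_eq_iff[THEN iffD2], rule allI)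
  fix S :: "'d set"
  let ?e = "from_nat_into S"
  let ?P = "{p. p permutes {..<m}}"
  let ?F = "{..<m} \<rightarrow>\<^sub>E (UNIV :: 'd set)"
  have coord: "(A *v x) $ k = (\<Sum>j\<in>UNIV. x $ j * (A *v axis j 1) $ k)" for x :: "real^'d" and k
    by (simp add: matrix_vector_mult_basis column_def) (simp add: matrix_vector_mult_def mult.commute)
  have "(\<Prod>i<m. (A *v v i) $ ?e (p i))
      = (\<Sum>f\<in>?F. (\<Prod>i<m. v i $ f i) * (\<Prod>i<m. (A *v axis (f i) 1) $ ?e (p i)))" for p
  proof -
    have "(\<Prod>i<m. (A *v v i) $ ?e (p i))
        = (\<Prod>i<m. \<Sum>j\<in>UNIV. v i $ j * (A *v axis j 1) $ ?e (p i))"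
      by (subst coord) simp
    also have "\<dots> = (\<Sum>f\<in>?F. \<Prod>i<m. v i $ f i * (A *v axis (f i) 1) $ ?e (p i))"
      by (rule prod_sum_PiE) auto
    finally show ?thesis by (simp add: prod.distrib)
  qed
  then have "(\<Sum>p\<in>?P. of_int (sign p) * (\<Prod>i<m. (A *v v i) $ ?e (p i)))
      = (\<Sum>p\<in>?P. \<Sum>f\<in>?F. (\<Prod>i<m. v i $ f i) *
          (of_int (sign p) * (\<Prod>i<m. (A *v axis (f i) 1) $ ?e (p i))))"
    by (simp add: sum_distrib_left mult_ac)
  also have "\<dots> = (\<Sum>f\<in>?F. (\<Prod>i<m. v i $ f i) *
          (\<Sum>p\<in>?P. of_int (sign p) * (\<Prod>i<m. (A *v axis (f i) 1) $ ?e (p i))))"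
    by (subst sum.swap) (simp add: sum_distrib_left)
  finally show "wedge m (\<lambda>i. A *v v i) $ S =
    (\<Sum>f\<in>?F. (\<Prod>i<m. v i $ f i) *\<^sub>R wedge m (\<lambda>i. A *v axis (f i) 1)) $ S"
    by (simp add: wedge_nth)
qed

lemma bij_betw_subset_permutation:
  "bij_betw (\<lambda>(T, p). \<lambda>i\<in>{..<m}. from_nat_into T (p i))
     ({T :: 'd::finite set. card T = m} \<times> {p. p permutes {..<m}})
     {f \<in> {..<m} \<rightarrow>\<^sub>E UNIV. inj_on f {..<m}}"
proof -
  let ?g = "\<lambda>(T :: 'd set, p). \<lambda>i\<in>{..<m}. from_nat_into T (p i)"
  have e: "bij_betw (from_nat_into T) {..<card T} T" for T :: "'d set"
    by (rule bij_betw_from_nat_into_finite) simp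
  have img: "?g (T, p) ` {..<m} = T" and inj: "inj_on (?g (T, p)) {..<m}"
    if "card T = m" "p permutes {..<m}" for T p
  proof -
    have "bij_betw (from_nat_into T \<circ> p) {..<m} T"
      using e[of T] that permutes_imp_bij bij_betw_trans by blast
    then have "bij_betw (?g (T, p)) {..<m} T"
      by (subst bij_betw_cong[where g = "from_nat_into T \<circ> p"]) auto
    then show "?g (T, p) ` {..<m} = T" "inj_on (?g (T, p)) {..<m}"
      by (auto simp: bij_betw_def)
  qed
  show ?thesis
  proof (rule bij_betwI')
    fix x y :: "'d set \<times> (nat \<Rightarrow> nat)"
    assume x: "x \<in> {T. card T = m} \<times> {p. p permutes {..<m}}"
      and y: "y \<in> {T. card T = m} \<times> {p. p permutes {..<m}}"
    obtain T p U q where xy: "x = (T, p)" "y = (U, q)" by (metis surj_pair)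
    have "x = y" if eq: "?g x = ?g y"
    proof -
      have "T = ?g (T, p) ` {..<m}" using img[of T p] x xy by blast
      also have "\<dots> = ?g (U, q) ` {..<m}" using eq xy by metis
      also have "\<dots> = U" using img[of U q] y xy by blast
      finally have TU: "T = U" .
      have "p i = q i" for i
      proof (cases "i < m")
        case True
        then have "from_nat_into T (p i) = from_nat_into T (q i)"
          using fun_cong[OF eq, of i] xy TU by simp
        moreover have "p i < m" "q i < m"
          using True x y xy permutes_in_image[of p "{..<m}" i] permutes_in_image[of q "{..<m}" i]
          by auto
        ultimately show ?thesis
          using e[of T] x xy by (auto simp: bij_betw_def inj_on_def)
      next
        case False
        then show ?thesis using x y xy by (simp add: permutes_def)
      qed
      then show ?thesis using TU xy by (simp add: fun_eq_iff)
    qed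
    then show "(?g x = ?g y) = (x = y)" by auto
  next
    fix x :: "'d set \<times> (nat \<Rightarrow> nat)"
    assume x: "x \<in> {T. card T = m} \<times> {p. p permutes {..<m}}"
    show "?g x \<in> {f \<in> {..<m} \<rightarrow>\<^sub>E UNIV. inj_on f {..<m}}"
    proof -
      obtain T p where xx: "x = (T, p)" by (cases x)
      have "?g (T, p) \<in> {..<m} \<rightarrow>\<^sub>E UNIV" by simp
      moreover have "inj_on (?g (T, p)) {..<m}" using inj[of T p] x xx by blast
      ultimately show ?thesis unfolding xx by blast
    qed
  next
    fix f :: "nat \<Rightarrow> 'd"
    assume f: "f \<in> {f \<in> {..<m} \<rightarrow>\<^sub>E UNIV. inj_on f {..<m}}"
    define T where "T = f ` {..<m}"
    define p where "p = (\<lambda>i. if i < m then inv_into {..<m} (from_nat_into T) (f i) else i)"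
    have T: "card T = m" using f by (simp add: T_def card_image)
    have bij: "bij_betw f {..<m} T" using f by (simp add: T_def bij_betw_def)
    have "bij_betw (inv_into {..<m} (from_nat_into T) \<circ> f) {..<m} {..<m}"
      using bij_betw_trans[OF bij] bij_betw_inv_into e[of T] T by blast
    then have "bij_betw p {..<m} {..<m}"
      by (subst bij_betw_cong[where g = "inv_into {..<m} (from_nat_into T) \<circ> f"])
        (auto simp: p_def)
    then have p: "p permutes {..<m}"
      by (rule bij_imp_permutes) (auto simp: p_def)
    have "f i = ?g (T, p) i" for i
    proof (cases "i < m")
      case True
      then have "f i \<in> from_nat_into T ` {..<m}"
        using e[of T] T by (auto simp: bij_betw_def T_def)
      then show ?thesis using True by (simp add: p_def f_inv_into_f)
    next
      case False
      then show ?thesis using f by (auto simp: PiE_def extensional_def)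
    qed
    then have "f = ?g (T, p)" by (simp add: fun_eq_iff)
    then show "\<exists>x\<in>{T. card T = m} \<times> {p. p permutes {..<m}}. f = ?g x"
      using T p by blast
  qed
qed

lemma exterior_map_wedge: "exterior_map m A (wedge m v) = wedge m (\<lambda>i. A *v v i)"
  for v :: "nat \<Rightarrow> real^'d" and A :: "real^'d^'d"
proof -
  let ?P = "{p. p permutes {..<m}}"
  let ?C = "{T :: 'd set. card T = m}"
  let ?F = "{..<m} \<rightarrow>\<^sub>E (UNIV :: 'd set)"
  let ?h = "\<lambda>f. (\<Prod>i<m. v i $ f i) *\<^sub>R wedge m (\<lambda>i. A *v axis (f i) 1)"
  have "wedge m (\<lambda>i. A *v v i) = sum ?h ?F"
    by (rule wedge_matrix_expand)
  also have "\<dots> = sum ?h {f \<in> ?F. inj_on f {..<m}}"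
  proof (rule sum.mono_neutral_right)
    show "\<forall>f\<in>?F - {f \<in> ?F. inj_on f {..<m}}. ?h f = 0"
    proof
      fix f assume "f \<in> ?F - {f \<in> ?F. inj_on f {..<m}}"
      then obtain i j where "i < m" "j < m" "i \<noteq> j" "f i = f j"
        by (auto simp: inj_on_def)
      then show "?h f = 0"
        using wedge_eq_0[of i m j "\<lambda>i. A *v axis (f i) 1"] by simp
    qed
  qed (auto intro: finite_PiE)
  also have "\<dots> = (\<Sum>x\<in>?C \<times> ?P. ?h ((\<lambda>(T, p). \<lambda>i\<in>{..<m}. from_nat_into T (p i)) x))"
    by (rule sum.reindex_bij_betw[symmetric]) (rule bij_betw_subset_permutation)
  also have "\<dots> = (\<Sum>T\<in>?C. \<Sum>p\<in>?P. ?h (\<lambda>i\<in>{..<m}. from_nat_into T (p i)))"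
    by (simp add: sum.cartesian_product case_prod_unfold)
  also have "\<dots> = (\<Sum>T\<in>?C. \<Sum>p\<in>?P. (of_int (sign p) * (\<Prod>i<m. v i $ from_nat_into T (p i)))
      *\<^sub>R wedge m (\<lambda>i. A *v axis (from_nat_into T i) 1))"
  proof (intro sum.cong refl)
    fix T :: "'d set" and p assume "p \<in> ?P"
    then have p: "p permutes {..<m}" by simp
    have "wedge m (\<lambda>i. A *v axis ((\<lambda>i\<in>{..<m}. from_nat_into T (p i)) i) 1)
        = wedge m ((\<lambda>i. A *v axis (from_nat_into T i) 1) \<circ> p)"
      by (rule wedge_cong) simp
    also have "\<dots> = of_int (sign p) *\<^sub>R wedge m (\<lambda>i. A *v axis (from_nat_into T i) 1)"
      by (rule wedge_permute[OF p])
    finally show "?h (\<lambda>i\<in>{..<m}. from_nat_into T (p i))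
        = (of_int (sign p) * (\<Prod>i<m. v i $ from_nat_into T (p i)))
          *\<^sub>R wedge m (\<lambda>i. A *v axis (from_nat_into T i) 1)"
      by (simp add: mult.commute)
  qed
  also have "\<dots> = exterior_map m A (wedge m v)"
    unfolding exterior_map_def
    by (intro sum.cong) (simp_all add: wedge_nth scaleR_sum_left)
  finally show ?thesis ..
qed

lemma linear_exterior_map: "linear (exterior_map m A)"
  unfolding exterior_map_def
  by (rule linearI) (simp_all add: scaleR_add_left sum.distrib scaleR_sum_right)

lemma wedge_basis:
  assumes S: "card S = m"
  shows "wedge m (\<lambda>i. axis (from_nat_into S i) 1) = (axis S 1 :: real^('d::finite set))"
proof (rule vec_eq_iff[THEN iffD2], rule allI)
  fix T :: "'d set"
  let ?P = "{p. p permutes {..<m}}"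
  let ?t = "\<lambda>p. of_int (sign p) *
    (\<Prod>i<m. axis (from_nat_into S i) (1::real) $ from_nat_into T (p i))"
  have e: "bij_betw (from_nat_into U) {..<card U} U" for U :: "'d set"
    by (rule bij_betw_from_nat_into_finite) simp
  have zero: "?t p = 0" if "i < m" "from_nat_into S i \<noteq> from_nat_into T (p i)" for p i
  proof -
    have "(\<Prod>i<m. axis (from_nat_into S i) (1::real) $ from_nat_into T (p i)) = 0"
      using that by (intro prod_zero bexI[of _ i]) (auto simp: axis_def)
    then show ?thesis by simp
  qed
  show "wedge m (\<lambda>i. axis (from_nat_into S i) 1) $ T = (axis S 1 :: real^('d set)) $ T"
  proof (cases "card T = m")
    case True
    show ?thesis
    proof (cases "T = S")
      case TS: True
      have "sum ?t ?P = sum ?t {id}"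
      proof (rule sum.mono_neutral_right)
        show "\<forall>p\<in>?P - {id}. ?t p = 0"
        proof
          fix p assume p: "p \<in> ?P - {id}"
          then obtain i where i: "p i \<noteq> i" by (auto simp: fun_eq_iff)
          with p have im: "i < m" by (auto simp: permutes_def)
          then have "p i < m" using p permutes_in_image[of p "{..<m}" i] by simp
          moreover have "inj_on (from_nat_into S) {..<m}"
            using e[of S] S by (simp add: bij_betw_def)
          ultimately have "from_nat_into S i \<noteq> from_nat_into T (p i)"
            using i im TS by (metis inj_onD lessThan_iff)
          then show "?t p = 0" using im zero by blast
        qed
      qed (auto simp: permutes_id finite_permutations)
      then show ?thesis using True TS by (simp add: wedge_nth axis_def)
    next
      case False
      have "?t p = 0" if p: "p \<in> ?P" for p
      proof (rule ccontr)
        assume "?t p \<noteq> 0"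
        then have eq: "from_nat_into S i = from_nat_into T (p i)" if "i < m" for i
          using zero that by blast
        have "S = from_nat_into S ` {..<m}" using e[of S] S by (simp add: bij_betw_def)
        also have "\<dots> = from_nat_into T ` p ` {..<m}" unfolding image_image using eq by (intro image_cong) auto
        also have "\<dots> = T" using p e[of T] True by (simp add: permutes_image bij_betw_def)
        finally show False using False by simp
      qed
      then have "sum ?t ?P = 0" by (intro sum.neutral) blast
      moreover have "wedge m (\<lambda>i. axis (from_nat_into S i) 1) $ T = sum ?t ?P"
        using True by (simp only: wedge_nth refl if_True)
      moreover have "(axis S 1 :: real^('d set)) $ T = 0"
        using False by (simp add: axis_def)
      ultimately show ?thesis by simp
    qed
  next
    case False
    then show ?thesis using S by (auto simp: wedge_nth axis_def)
  qed
qed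

lemma exterior_power_eq:
  "exterior_power m = {x :: real^('d::finite set). \<forall>S. card S \<noteq> m \<longrightarrow> x $ S = 0}"
proof
  show "exterior_power m \<subseteq> {x :: real^('d set). \<forall>S. card S \<noteq> m \<longrightarrow> x $ S = 0}"
    unfolding exterior_power_def
    by (rule span_minimal) (auto simp: wedge_nth subspace_def)
  show "{x :: real^('d set). \<forall>S. card S \<noteq> m \<longrightarrow> x $ S = 0} \<subseteq> exterior_power m"
  proof
    fix x :: "real^('d set)"
    assume x: "x \<in> {x. \<forall>S. card S \<noteq> m \<longrightarrow> x $ S = 0}"
    have "x = (\<Sum>S\<in>UNIV. x $ S *\<^sub>R axis S 1)"
      using basis_expansion[of x] by (simp add: scalar_mult_eq_scaleR)
    also have "\<dots> \<in> exterior_power m"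
      unfolding exterior_power_def
    proof (rule span_sum)
      fix S :: "'d set"
      show "x $ S *\<^sub>R axis S 1 \<in> span (range (wedge m))"
      proof (cases "card S = m")
        case True
        then show ?thesis
          by (metis rangeI span_base span_scale wedge_basis)
      next
        case False
        then show ?thesis using x by (simp add: span_zero)
      qed
    qed
    finally show "x \<in> exterior_power m" .
  qed
qed

end

theory Submission
  imports Defs
begin

text \<open>
  If for some \<open>k \<ge> 1\<close> the vectors \<open>A\<^sub>K u\<close> with \<open>K\<close> of length \<open>k\<close> span the whole space for every
  \<open>u \<noteq> 0\<close>, then quasi-multiplicativity follows from compactness of the unit sphere. Otherwise,
  compactness gives one vector \<open>u\<close> whose spans \<open>V\<^sub>k\<close> are proper for all \<open>k\<close>. Their dimensions
  stabilise, so eventually every \<open>A\<^sub>i\<close> maps \<open>V\<^sub>k\<close> onto \<open>V\<^sub>k\<^sub>+\<^sub>1\<close>, and \<open>V\<^sub>k\<close> is invariant under the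
  matrices \<open>A\<^sub>1\<^sup>-\<^sup>n A\<^sub>I\<close> with \<open>I\<close> of length \<open>n\<close>.

  Let \<open>W\<^sub>0\<close> be a nonzero subspace of minimal dimension \<open>m < d\<close> invariant under these matrices and put
  \<open>W\<^sub>k = A\<^sub>1\<^sup>k W\<^sub>0\<close>. For the least \<open>q\<close> with \<open>W\<^sub>q\<close> contained in \<open>W\<^sub>0 + \<dots> + W\<^sub>q\<^sub>-\<^sub>1\<close>, the latter sum is direct
  and invariant under all \<open>A\<^sub>i\<close>, so it is everything and \<open>d = q m\<close>. Projecting along
  \<open>W\<^sub>1 + \<dots> + W\<^sub>q\<^sub>-\<^sub>1\<close> embeds \<open>W\<^sub>q\<close> equivariantly into \<open>W\<^sub>0\<close>. The subspaces \<open>W\<^sub>k\<^sub>q\<close> are thus all equivalent to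
  \<open>W\<^sub>0\<close>, and they span by irreducibility of the \<open>q\<close>-th power, so every \<open>W\<^sub>k\<close> is equivalent to \<open>W\<^sub>0\<close>.
  Hence each \<open>A\<^sub>1\<^sup>-\<^sup>n A\<^sub>I\<close> acts on all the lines \<open>\<Lambda>\<^sup>m W\<^sub>k\<close> by the same scalar. These lines span the
  exterior power by irreducibility, so the action on it is scalar, and as \<open>1 \<le> m < d\<close> the matrix
  itself is scalar. Therefore all \<open>A\<^sub>i\<close> are multiples of \<open>A\<^sub>1\<close>, all products lie in the commutant of an
  irreducible family, and there the norm is multiplicative up to a constant by Schur's lemma and
  compactness.
\<close>

section \<open>Exterior powers\<close>

lemma matrix_extend:
  fixes f :: "real^'a \<Rightarrow> real^'b"
  assumes "independent B"
  obtains M :: "real^'a^'b" where "\<And>x. x \<in> B \<Longrightarrow> M *v x = f x"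
proof -
  obtain g where "linear g" "\<forall>x\<in>B. g x = f x"
    using linear_independent_extend[OF assms, of f] by blast
  then have "\<And>x. x \<in> B \<Longrightarrow> matrix g *v x = f x"
    by (simp add: matrix_works)
  then show thesis by (rule that)
qed

text \<open>Matrices on the whole space, rather than linear maps on a subspace, are used because
  \<open>exterior_map\<close> takes a matrix.\<close>

lemma matrix_extend_indexed:
  fixes e :: "nat \<Rightarrow> real^'a" and f :: "nat \<Rightarrow> real^'b"
  assumes "inj_on e {..<m}" "independent (e ` {..<m})"
  obtains M :: "real^'a^'b" where "\<And>i. i < m \<Longrightarrow> M *v e i = f i"
proof -
  obtain M :: "real^'a^'b" where M: "\<And>x. x \<in> e ` {..<m} \<Longrightarrow> M *v x = (f \<circ> inv_into {..<m} e) x"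
    using matrix_extend[OF assms(2), of "f \<circ> inv_into {..<m} e"] by blast
  then have "\<And>i. i < m \<Longrightarrow> M *v e i = f i"
    using assms(1) by simp
  then show thesis by (rule that)
qed

lemma independent_indexed_dim:
  fixes e :: "nat \<Rightarrow> real^'d"
  assumes "inj_on e {..<m}" "independent (e ` {..<m})"
  shows "m \<le> CARD('d)"
  using independent_card_le[OF assms(2)] card_image[OF assms(1)] by simp

lemma wedge_eq_axis:
  assumes "card S = m" "\<And>i. i < m \<Longrightarrow> v i = axis (from_nat_into S i) 1"
  shows "wedge m v = (axis S 1 :: real^('d::finite set))"
  using wedge_cong[of m v "\<lambda>i. axis (from_nat_into S i) 1"] assms wedge_basis[of S m] by simp

lemma wedge_zero:
  fixes v :: "nat \<Rightarrow> real^'d"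
  assumes "j < m" "v j = 0"
  shows "wedge m v = 0"
proof -
  have "(\<Prod>i<m. v i $ from_nat_into S (p i)) = 0" for S :: "'d set" and p
    using assms by (intro prod_zero bexI[of _ j]) auto
  then show ?thesis
    by (simp add: vec_eq_iff wedge_nth del: prod_zero_iff)
qed

text \<open>A matrix sending the independent vectors to standard basis vectors sends their wedge to
  a basis vector of the exterior power, whereas the induced linear map would send 0 to 0.\<close>

lemma wedge_nonzero:
  fixes e :: "nat \<Rightarrow> real^'d"
  assumes e: "inj_on e {..<m}" "independent (e ` {..<m})"
  shows "wedge m e \<noteq> 0"
proof
  assume 0: "wedge m e = 0"
  obtain S :: "'d set" where S: "card S = m"
    using obtain_subset_with_card_n independent_indexed_dim[OF e] by metis
  obtain M :: "real^'d^'d" where M: "\<And>i. i < m \<Longrightarrow> M *v e i = axis (from_nat_into S i) 1"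
    using matrix_extend_indexed[OF e, of "\<lambda>i. axis (from_nat_into S i) 1"] by blast
  have "axis S 1 = wedge m (\<lambda>i. M *v e i)"
    using wedge_eq_axis[OF S M] by simp
  also have "\<dots> = exterior_map m M 0"
    using exterior_map_wedge[of m M e] 0 by simp
  also have "\<dots> = 0"
    by (rule linear_0[OF linear_exterior_map])
  finally show False
    by (simp add: axis_eq_0_iff)
qed

text \<open>The top exterior power of an m-dimensional space is a line. The span is transported by
  \<open>M\<close> to the coordinate subspace of an index set \<open>S\<close>, where every minor on
  columns other than \<open>S\<close> has a vanishing factor in each term; \<open>N\<close>
  transports the result back.\<close>

lemma wedge_in_span:
  fixes e x :: "nat \<Rightarrow> real^'d"
  assumes e: "inj_on e {..<m}" "independent (e ` {..<m})"
    and x: "\<And>i. i < m \<Longrightarrow> x i \<in> span (e ` {..<m})"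
  obtains c where "wedge m x = c *\<^sub>R wedge m e"
proof -
  obtain S :: "'d set" where S: "card S = m"
    using obtain_subset_with_card_n independent_indexed_dim[OF e] by metis
  let ?a = "\<lambda>i. axis (from_nat_into S i) 1 :: real^'d"
  have bij: "bij_betw (from_nat_into S) {..<m} S"
    using bij_betw_from_nat_into_finite[of S] S by simp
  then have inS: "i < m \<Longrightarrow> from_nat_into S i \<in> S" for i
    by (auto simp: bij_betw_def)
  have inj_a: "inj_on ?a {..<m}"
    using bij by (auto simp: bij_betw_def inj_on_def axis_eq_axis)
  have "?a ` {..<m} \<subseteq> Basis"
    by (auto simp: Basis_vec_def)
  then have ind_a: "independent (?a ` {..<m})"
    using independent_Basis independent_mono by blast
  obtain M :: "real^'d^'d" where M: "\<And>i. i < m \<Longrightarrow> M *v e i = ?a i"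
    using matrix_extend_indexed[OF e, of ?a] by blast
  obtain N :: "real^'d^'d" where N: "\<And>i. i < m \<Longrightarrow> N *v ?a i = e i"
    using matrix_extend_indexed[OF inj_a ind_a, of e] by blast
  have NM: "N *v (M *v y) = y" if "y \<in> span (e ` {..<m})" for y
  proof -
    have "y \<in> {y. N *v (M *v y) = y}"
      using that
    proof (rule span_subspace_induct)
      show "subspace {y. N *v (M *v y) = y}"
        by (auto simp: subspace_def matrix_vector_right_distrib matrix_vector_mult_scaleR)
    qed (use M N in auto)
    then show ?thesis by simp
  qed
  have supp: "(M *v x i) $ t = 0" if "i < m" "t \<notin> S" for i t
  proof -
    have "x i \<in> {y. (M *v y) $ t = 0}"
      using x[OF that(1)]
    proof (rule span_subspace_induct)
      show "subspace {y. (M *v y) $ t = 0}"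
        by (auto simp: subspace_def matrix_vector_right_distrib matrix_vector_mult_scaleR)
    qed (use M inS that in \<open>auto simp: axis_def\<close>)
    then show ?thesis by simp
  qed
  define w where "w = wedge m (\<lambda>i. M *v x i)"
  have "w $ T = 0" if "T \<noteq> S" for T
  proof (cases "card T = m")
    case True
    have "\<not> T \<subseteq> S"
      using that True S card_subset_eq[of S T] by auto
    then obtain t where t: "t \<in> T" "t \<notin> S"
      by blast
    have bT: "bij_betw (from_nat_into T) {..<m} T"
      using bij_betw_from_nat_into_finite[of T] True by simp
    have "(\<Prod>i<m. (M *v x i) $ from_nat_into T (p i)) = 0" if p: "p permutes {..<m}" for p
    proof -
      have "t \<in> from_nat_into T ` p ` {..<m}"
        using bT t p by (simp add: permutes_image bij_betw_def)
      then obtain i where "i < m" "from_nat_into T (p i) = t" by auto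
      then show ?thesis
        using supp t by (intro prod_zero) auto
    qed
    then have "(\<Sum>p | p permutes {..<m}. of_int (sign p) * (\<Prod>i<m. (M *v x i) $ from_nat_into T (p i))) = 0"
      by (intro sum.neutral) simp
    then show ?thesis by (simp add: w_def wedge_nth)
  qed (simp add: w_def wedge_nth)
  then have w: "w = (w $ S) *\<^sub>R axis S 1"
    by (auto simp: vec_eq_iff axis_def)
  have a: "axis S 1 = wedge m (\<lambda>i. M *v e i)"
    using wedge_eq_axis[OF S M] by simp
  have "wedge m x = wedge m (\<lambda>i. N *v (M *v x i))"
    using NM x by (intro wedge_cong) simp
  also have "\<dots> = exterior_map m N w"
    by (simp add: w_def exterior_map_wedge)
  also have "\<dots> = (w $ S) *\<^sub>R exterior_map m N (axis S 1)"
    by (subst w) (simp add: linear_cmul[OF linear_exterior_map])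
  also have "exterior_map m N (axis S 1) = wedge m (\<lambda>i. N *v (M *v e i))"
    by (simp add: a exterior_map_wedge)
  also have "\<dots> = wedge m e"
    using M N by (intro wedge_cong) simp
  finally show thesis by (rule that)
qed

text \<open>For x and y independent, comparing coefficients in the image of x + y forces equal
  eigenvalues; for y a multiple of x linearity does.\<close>

lemma eigenvectors_imp_scalar:
  fixes g :: "real^'d^'d"
  assumes ev: "\<And>x. g *v x \<in> span {x}"
  obtains c where "\<And>x. g *v x = c *\<^sub>R x"
proof -
  have "\<exists>k. g *v x = k *\<^sub>R x" for x
    using ev[of x] by (auto simp: span_singleton)
  then obtain f where f: "\<And>x. g *v x = f x *\<^sub>R x" by metis
  have "f x = f y" if "x \<noteq> 0" "y \<noteq> 0" for x y
  proof (cases "y \<in> span {x}")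
    case True
    then obtain k where k: "y = k *\<^sub>R x" by (auto simp: span_singleton)
    have "g *v y = k *\<^sub>R (g *v x)"
      by (simp add: k matrix_vector_mult_scaleR)
    then have "f y *\<^sub>R y = k *\<^sub>R (f x *\<^sub>R x)"
      by (simp only: f)
    then have "f y *\<^sub>R y = f x *\<^sub>R y" unfolding k by (simp only: scaleR_scaleR mult.commute)
    then show ?thesis using that by simp
  next
    case False
    then have "x \<noteq> y" using span_base by blast
    have "independent {y, x}"
      using False that by (simp add: independent_insert)
    have "f (x + y) *\<^sub>R (x + y) = f x *\<^sub>R x + f y *\<^sub>R y"
      using f[of "x + y"] f[of x] f[of y] by (simp add: matrix_vector_right_distrib)
    then have eq: "(f (x + y) - f y) *\<^sub>R y = (f x - f (x + y)) *\<^sub>R x"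
      by (simp add: algebra_simps)
    have fy: "f (x + y) = f y"
    proof (rule ccontr)
      assume ne: "f (x + y) \<noteq> f y"
      have "(f (x + y) - f y) *\<^sub>R y \<in> span {x}"
        unfolding eq by (intro span_scale span_base) simp
      then have "(1 / (f (x + y) - f y)) *\<^sub>R ((f (x + y) - f y) *\<^sub>R y) \<in> span {x}"
        by (rule span_scale)
      then show False using ne False by simp
    qed
    then show ?thesis using eq that by simp
  qed
  then obtain c where "\<And>x. x \<noteq> 0 \<Longrightarrow> f x = c" by metis
  then have "g *v x = c *\<^sub>R x" for x
    using f[of x] by (cases "x = 0") auto
  then show thesis by (rule that)
qed

text \<open>If g x were not a multiple of x, take an m-element set \<open>D\<close> containing x
  such that \<open>D\<close> together with g x is independent. A matrix \<open>M\<close> killing g x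
  and fixing \<open>D\<close> kills the wedge of the vectors g v over v in \<open>D\<close>, but
  this wedge is c times that of \<open>D\<close>, which \<open>M\<close> fixes.\<close>

lemma exterior_scalar_imp_scalar:
  fixes g :: "real^'d^'d"
  assumes m: "1 \<le> m" "m < CARD('d)" and inv: "invertible g"
    and c: "\<And>v. wedge m (\<lambda>i. g *v v i) = c *\<^sub>R wedge m v"
  obtains k where "\<And>x. g *v x = k *\<^sub>R x"
proof -
  have "g *v x \<in> span {x}" for x
  proof (rule ccontr)
    assume gx: "g *v x \<notin> span {x}"
    let ?y = "g *v x"
    have x0: "x \<noteq> 0" using gx span_0 by force
    have xy: "x \<noteq> ?y" using gx span_base[of x "{x}"] by auto
    have ind: "independent {?y, x}"
      using gx x0 by (simp add: independent_insert)
    obtain B where B: "{?y, x} \<subseteq> B" "independent B" "UNIV \<subseteq> span B"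
      using maximal_independent_subset_extend[OF subset_UNIV ind] by metis
    have finB: "finite B" using B(2) by (rule independent_imp_finite)
    have cB: "card B = CARD('d)"
      using basis_card_eq_dim[of B UNIV] B by (simp add: dim_UNIV)
    \<comment> \<open>Here m < d is used: d - 2 basis vectors remain besides x and g x, enough for
      the other m - 1 elements of \<open>D\<close>.\<close>
    have "m - 1 \<le> card (B - {?y, x})"
      using m cB B(1) finB xy by (subst card_Diff_subset) auto
    then obtain C where C: "C \<subseteq> B - {?y, x}" "card C = m - 1" "finite C"
      by (rule obtain_subset_with_card_n)
    define D where "D = insert x C"
    have cD: "card D = m" "finite D" using C m by (auto simp: D_def card_insert_if)
    have D: "x \<in> D" "?y \<notin> D" "D \<subseteq> B" using C B xy by (auto simp: D_def)
    have indy: "independent (insert ?y D)"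
      using B(1) D by (intro independent_mono[OF B(2)]) auto
    obtain v where v: "bij_betw v {..<m} D"
      using ex_bij_betw_nat_finite[OF cD(2)] cD(1) by (auto simp: atLeast0LessThan)
    have vD: "v ` {..<m} = D" "inj_on v {..<m}" using v by (auto simp: bij_betw_def)
    obtain j where j: "j < m" "v j = x" using vD D by (metis imageE lessThan_iff)
    obtain M :: "real^'d^'d" where M: "\<And>z. z \<in> insert ?y D \<Longrightarrow> M *v z = (if z = ?y then 0 else z)"
      using matrix_extend[OF indy, of "\<lambda>z. if z = ?y then 0 else z"] by blast
    have vne: "wedge m v \<noteq> 0"
      using vD indy independent_mono by (intro wedge_nonzero) blast+
    \<comment> \<open>With c = 0 the inverse of g would recover the nonzero wedge from 0.\<close>
    have "c \<noteq> 0"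
    proof
      assume "c = 0"
      obtain h where h: "h ** g = mat 1" using inv by (auto simp: invertible_def)
      have "wedge m v = wedge m (\<lambda>i. h *v (g *v v i))"
        by (simp add: matrix_vector_mul_assoc h)
      also have "\<dots> = exterior_map m h (c *\<^sub>R wedge m v)"
        using exterior_map_wedge[of m h "\<lambda>i. g *v v i"] c by simp
      also have "\<dots> = 0" using \<open>c = 0\<close> by (simp add: linear_0[OF linear_exterior_map])
      finally show False using vne by simp
    qed
    have "wedge m (\<lambda>i. M *v (g *v v i)) = 0"
      using j M[of ?y] by (intro wedge_zero[of j]) auto
    moreover have "wedge m (\<lambda>i. M *v (g *v v i)) = c *\<^sub>R wedge m (\<lambda>i. M *v v i)"
      using exterior_map_wedge[of m M "\<lambda>i. g *v v i"] exterior_map_wedge[of m M v] c[of v]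
      by (simp add: linear_cmul[OF linear_exterior_map])
    moreover have "wedge m (\<lambda>i. M *v v i) = wedge m v"
    proof (rule wedge_cong)
      fix i assume "i < m"
      then have "v i \<in> D" using vD by auto
      then show "M *v v i = v i" using M[of "v i"] D by auto
    qed
    ultimately show False using vne \<open>c \<noteq> 0\<close> by simp
  qed
  then show thesis using eigenvectors_imp_scalar that by blast
qed

section \<open>Minimal invariant subspaces\<close>

definition invariant :: "(real^'d^'d) set \<Rightarrow> (real^'d) set \<Rightarrow> bool" where
  "invariant \<Gamma> U \<longleftrightarrow> subspace U \<and> (\<forall>g\<in>\<Gamma>. \<forall>x\<in>U. g *v x \<in> U)"

text \<open>Minimality is by dimension, not inclusion. It passes to images under invertible matrices
  by counting dimensions, so the one-sided relation g B = B h suffices in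
  \<open>minimal_invariant_image\<close>.\<close>

definition minimal_invariant :: "(real^'d^'d) set \<Rightarrow> (real^'d) set \<Rightarrow> bool" where
  "minimal_invariant \<Gamma> U \<longleftrightarrow> invariant \<Gamma> U \<and> U \<noteq> {0} \<and>
     (\<forall>V. invariant \<Gamma> V \<longrightarrow> V \<noteq> {0} \<longrightarrow> dim U \<le> dim V)"

text \<open>There is a linear injection \<open>U \<rightarrow> V\<close> commuting with \<open>\<Gamma>\<close>; it is encoded by a matrix on the whole
  space so that it induces a map on the exterior power.\<close>

definition embeds :: "(real^'d^'d) set \<Rightarrow> (real^'d) set \<Rightarrow> (real^'d) set \<Rightarrow> bool" where
  "embeds \<Gamma> U V \<longleftrightarrow> (\<exists>M :: real^'d^'d. inj_on ((*v) M) U \<and> (*v) M ` U \<subseteq> V \<and>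
     (\<forall>g\<in>\<Gamma>. \<forall>x\<in>U. M *v (g *v x) = g *v (M *v x)))"

lemma embeds_refl: "embeds \<Gamma> U U"
  unfolding embeds_def by (intro exI[of _ "mat 1"]) (auto simp: inj_on_def)

lemma embeds_trans:
  fixes U V W :: "(real^'d) set"
  assumes "embeds \<Gamma> U V" "embeds \<Gamma> V W"
  shows "embeds \<Gamma> U W"
proof -
  obtain M :: "real^'d^'d" where M: "inj_on ((*v) M) U" "(*v) M ` U \<subseteq> V"
      "\<And>g x. g \<in> \<Gamma> \<Longrightarrow> x \<in> U \<Longrightarrow> M *v (g *v x) = g *v (M *v x)"
    using assms(1) unfolding embeds_def by blast
  obtain N :: "real^'d^'d" where N: "inj_on ((*v) N) V" "(*v) N ` V \<subseteq> W"
      "\<And>g x. g \<in> \<Gamma> \<Longrightarrow> x \<in> V \<Longrightarrow> N *v (g *v x) = g *v (N *v x)"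
    using assms(2) unfolding embeds_def by blast
  have "inj_on ((*v) N \<circ> (*v) M) U"
    using M(1,2) N(1) by (meson comp_inj_on inj_on_subset)
  then have "inj_on ((*v) (N ** M)) U"
    by (simp add: o_def matrix_vector_mul_assoc)
  moreover have "(*v) (N ** M) ` U \<subseteq> W"
    using M(2) N(2) by (auto simp flip: matrix_vector_mul_assoc)
  moreover have "(N ** M) *v (g *v x) = g *v ((N ** M) *v x)" if "g \<in> \<Gamma>" "x \<in> U" for g x
  proof -
    have "M *v x \<in> V" using M(2) that by auto
    then show ?thesis
      using M(3)[OF that] N(3)[OF that(1)] by (simp flip: matrix_vector_mul_assoc)
  qed
  ultimately show ?thesis
    unfolding embeds_def by blast
qed

lemma minimal_invariantD:
  assumes "minimal_invariant \<Gamma> U"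
  shows "invariant \<Gamma> U" "subspace U" "U \<noteq> {0}"
  using assms by (auto simp: minimal_invariant_def invariant_def)

text \<open>A nonzero intersection is itself invariant, so it cannot have smaller dimension than
  U.\<close>

lemma minimal_invariant_Int:
  assumes "minimal_invariant \<Gamma> U" "invariant \<Gamma> V"
  shows "U \<inter> V = {0} \<or> U \<subseteq> V"
proof (cases "U \<inter> V = {0}")
  case False
  have "invariant \<Gamma> (U \<inter> V)"
    using assms by (auto simp: minimal_invariant_def invariant_def subspace_inter)
  then have "dim U \<le> dim (U \<inter> V)" "subspace (U \<inter> V)"
    using False assms by (auto simp: minimal_invariant_def invariant_def)
  then have "U \<inter> V = U"
    using minimal_invariantD(2)[OF assms(1)] by (intro subspace_dim_equal) auto
  then show ?thesis by blast
qed simp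

lemma minimal_invariant_exists:
  fixes V :: "(real^'d) set"
  assumes "invariant \<Gamma> V" "V \<noteq> {0}"
  obtains U where "minimal_invariant \<Gamma> U" "dim U \<le> dim V"
proof -
  define P where "P U \<longleftrightarrow> invariant \<Gamma> U \<and> U \<noteq> {0}" for U
  have "P V" using assms by (simp add: P_def)
  then obtain U where "P U" "\<And>W. P W \<Longrightarrow> dim U \<le> dim W"
    using ex_has_least_nat[of P V dim] by blast
  then show thesis
    using that[of U] \<open>P V\<close> by (auto simp: P_def minimal_invariant_def)
qed

lemma invariant_span_Union:
  assumes "\<And>k. k \<in> N \<Longrightarrow> invariant \<Gamma> (W k)"
  shows "invariant \<Gamma> (span (\<Union>k\<in>N. W k))"
  unfolding invariant_def
proof (intro conjI ballI)
  fix g x assume g: "g \<in> \<Gamma>" and x: "x \<in> span (\<Union>k\<in>N. W k)"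
  have "x \<in> {x. g *v x \<in> span (\<Union>k\<in>N. W k)}"
    using x
  proof (rule span_subspace_induct)
    show "subspace {x. g *v x \<in> span (\<Union>k\<in>N. W k)}"
      by (auto simp: subspace_def matrix_vector_right_distrib matrix_vector_mult_scaleR
          span_zero span_add span_scale)
    show "x \<in> {x. g *v x \<in> span (\<Union>k\<in>N. W k)}" if "x \<in> (\<Union>k\<in>N. W k)" for x
      using that assms g unfolding invariant_def by (auto intro!: span_base)
  qed
  then show "g *v x \<in> span (\<Union>k\<in>N. W k)" by simp
qed simp

text \<open>The equivariant embedding is the projection onto \<open>V\<close> along \<open>S\<close>.\<close>

lemma embeds_along:
  fixes U V S :: "(real^'d) set"
  assumes U: "invariant \<Gamma> U" and V: "invariant \<Gamma> V" and S: "invariant \<Gamma> S"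
    and US: "U \<inter> S = {0}" and VS: "V \<inter> S = {0}"
    and sum: "\<And>x. x \<in> U \<Longrightarrow> \<exists>s\<in>S. \<exists>y\<in>V. x = s + y"
  shows "embeds \<Gamma> U V"
proof -
  have sub: "subspace U" "subspace V" "subspace S"
    using U V S by (auto simp: invariant_def)
  obtain B where B: "B \<subseteq> S" "independent B" "S \<subseteq> span B"
    using basis_exists[of S] by metis
  obtain C where C: "C \<subseteq> V" "independent C" "V \<subseteq> span C"
    using basis_exists[of V] by metis
  have sp: "span B = S" "span C = V"
    using B C sub span_minimal by blast+
  \<comment> \<open>The bases have dim S + dim V elements in all, which is the dimension of their
    joint span since S and V meet trivially.\<close>
  have ind: "independent (B \<union> C)"
  proof (rule card_le_dim_spanning)
    have "dim (span (B \<union> C)) + dim (S \<inter> V) = dim S + dim V"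
      unfolding span_Un sp by (rule dim_sums_Int[OF sub(3,2)])
    then have "dim (span (B \<union> C)) = card B + card C"
      using VS B(1-3) C(1-3) by (simp add: Int_commute basis_card_eq_dim)
    then show "card (B \<union> C) \<le> dim (span (B \<union> C))"
      using card_Un_le[of B C] by simp
  qed (auto simp: independent_imp_finite B(2) C(2) intro: span_base)
  have disj: "x \<notin> C" if "x \<in> B" for x
  proof
    assume "x \<in> C"
    then have "x \<in> V \<inter> S" using that B(1) C(1) by blast
    then show False using that B(2) dependent_zero[of B] VS by simp
  qed
  obtain M :: "real^'d^'d" where M: "\<And>x. x \<in> B \<union> C \<Longrightarrow> M *v x = (if x \<in> B then 0 else x)"
    using matrix_extend[OF ind, of "\<lambda>x. if x \<in> B then 0 else x"] by blast
  have MS: "M *v s = 0" if "s \<in> S" for s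
  proof -
    have "s \<in> {s. M *v s = 0}"
      using that unfolding sp(1)[symmetric]
      by (rule span_subspace_induct)
        (use M in \<open>auto simp: subspace_def matrix_vector_right_distrib matrix_vector_mult_scaleR\<close>)
    then show ?thesis by simp
  qed
  have MV: "M *v y = y" if "y \<in> V" for y
  proof -
    have "y \<in> {y. M *v y = y}"
      using that unfolding sp(2)[symmetric]
      by (rule span_subspace_induct)
        (use M disj in \<open>auto simp: subspace_def matrix_vector_right_distrib matrix_vector_mult_scaleR\<close>)
    then show ?thesis by simp
  qed
  have Msum: "M *v (s + y) = y" if "s \<in> S" "y \<in> V" for s y
    using MS[OF that(1)] MV[OF that(2)] by (simp add: matrix_vector_right_distrib)
  have "(*v) M ` U \<subseteq> V"
    using sum Msum by fastforce
  moreover have "inj_on ((*v) M) U"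
  proof (rule inj_onI)
    fix x x' assume x: "x \<in> U" "x' \<in> U" "M *v x = M *v x'"
    obtain s y where 1: "s \<in> S" "y \<in> V" "x - x' = s + y"
      using sum[of "x - x'"] x sub by (meson subspace_diff)
    have "M *v (x - x') = 0"
      using x(3) by (simp add: matrix_vector_mult_diff_distrib)
    then have "y = 0" using 1 Msum by simp
    then have "x - x' \<in> U \<inter> S" using 1 x sub by (auto intro: subspace_diff)
    then show "x = x'" using US by simp
  qed
  moreover have "M *v (g *v x) = g *v (M *v x)" if gx: "g \<in> \<Gamma>" "x \<in> U" for g x
  proof -
    obtain s y where 1: "s \<in> S" "y \<in> V" "x = s + y"
      using sum[OF gx(2)] by blast
    \<comment> \<open>Both summands are invariant, so g respects the decomposition x = s + y along
      which \<open>M\<close> projects.\<close>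
    have "g *v s \<in> S" "g *v y \<in> V"
      using 1 gx S V by (auto simp: invariant_def)
    then show ?thesis
      using 1 Msum by (simp add: matrix_vector_right_distrib MS MV)
  qed
  ultimately show ?thesis
    unfolding embeds_def by blast
qed

section \<open>Minimal invariant subspaces inside sums\<close>

lemma span_insert_sum:
  fixes W :: "'i \<Rightarrow> (real^'d) set"
  assumes "subspace (W k)" "x \<in> span (\<Union>i\<in>insert k N. W i)"
  shows "\<exists>s\<in>span (\<Union>i\<in>N. W i). \<exists>y\<in>W k. x = s + y"
proof -
  have "x \<in> span ((\<Union>i\<in>N. W i) \<union> W k)"
    using assms(2) by (simp add: Un_commute)
  moreover have "span (W k) = W k"
    using assms(1) by (rule span_eq_iff[THEN iffD2])
  ultimately show ?thesis
    unfolding span_Un by auto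
qed

text \<open>Summands are added one at a time. At the first one, W k, whose addition makes the sum
  contain U, both U and W k meet the earlier sum trivially, so projection along that sum embeds U
  into W k.\<close>

lemma embeds_summand_finite:
  assumes "finite N" "\<And>k. minimal_invariant \<Gamma> (W k)" "minimal_invariant \<Gamma> U"
    "U \<subseteq> span (\<Union>k\<in>N. W k)"
  shows "\<exists>k\<in>N. embeds \<Gamma> U (W k)"
  using assms(1,4)
proof (induction N)
  case empty
  then show ?case using minimal_invariantD[OF assms(3)] by (auto dest: subspace_0)
next
  case (insert k N)
  let ?T = "span (\<Union>k\<in>N. W k)"
  have inv: "invariant \<Gamma> (W i)" for i
    using minimal_invariantD[OF assms(2)] by blast
  have T: "invariant \<Gamma> ?T"
    by (rule invariant_span_Union) (rule inv)
  show ?case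
  proof (cases "U \<subseteq> ?T")
    case True
    then show ?thesis using insert.IH by blast
  next
    case False
    then have UT: "U \<inter> ?T = {0}"
      using minimal_invariant_Int[OF assms(3) T] by blast
    have "\<not> W k \<subseteq> ?T"
    proof
      assume "W k \<subseteq> ?T"
      then have "(\<Union>i\<in>insert k N. W i) \<subseteq> ?T"
        using span_superset[of "\<Union>k\<in>N. W k"] by blast
      then show False using insert.prems False span_minimal[OF _ subspace_span] by blast
    qed
    then have "W k \<inter> ?T = {0}"
      using minimal_invariant_Int[OF assms(2) T] by blast
    then have "embeds \<Gamma> U (W k)"
      using embeds_along[OF minimal_invariantD(1)[OF assms(3)] inv T UT]
        span_insert_sum[of W k _ N] minimal_invariantD(2)[OF assms(2)] insert.prems
      by blast
    then show ?thesis by blast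
  qed
qed

text \<open>One nonzero vector of U lies in the span of finitely many summands; by minimality all of
  U then does.\<close>

lemma embeds_summand:
  fixes U :: "(real^'d) set"
  assumes W: "\<And>k. minimal_invariant \<Gamma> (W k)" and U: "minimal_invariant \<Gamma> U"
    and sub: "U \<subseteq> span (\<Union>k\<in>N. W k)"
  shows "\<exists>k\<in>N. embeds \<Gamma> U (W k)"
proof -
  obtain u where u: "u \<in> U" "u \<noteq> 0"
    using minimal_invariantD[OF U] subspace_0 by blast
  then have "u \<in> span (\<Union>k\<in>N. W k)" using sub by blast
  then obtain t r where t: "finite t" "t \<subseteq> (\<Union>k\<in>N. W k)" "u = (\<Sum>a\<in>t. r a *\<^sub>R a)"
    by (auto simp: span_explicit)
  obtain K where K: "K \<subseteq> N" "finite K" "t \<subseteq> (\<Union>k\<in>K. W k)"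
  proof -
    have "\<forall>a\<in>t. \<exists>k\<in>N. a \<in> W k" using t(2) by blast
    then obtain h where "\<And>a. a \<in> t \<Longrightarrow> h a \<in> N \<and> a \<in> W (h a)" by metis
    then show thesis using that[of "h ` t"] t(1) by blast
  qed
  have "u \<in> span (\<Union>k\<in>K. W k)"
    unfolding t(3) using K(3) by (intro span_sum span_scale span_base) auto
  moreover have "invariant \<Gamma> (span (\<Union>k\<in>K. W k))"
    using minimal_invariantD(1)[OF W] by (intro invariant_span_Union)
  ultimately have "U \<subseteq> span (\<Union>k\<in>K. W k)"
    using minimal_invariant_Int[OF U] u by blast
  then show ?thesis
    using embeds_summand_finite[of K \<Gamma> W, OF K(2) W U] K(1) by blast
qed

section \<open>Transport by an invertible matrix\<close>

lemma invertible_inj: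
  fixes B :: "real^'d^'d"
  assumes "invertible B"
  shows "inj ((*v) B)"
  using assms matrix_left_invertible_injective[of B] by (auto simp: invertible_def)

lemma dim_image_invertible:
  fixes B :: "real^'d^'d"
  assumes "invertible B"
  shows "dim ((*v) B ` U) = dim U"
  using invertible_inj[OF assms] by (intro dim_image_eq) (auto intro: inj_on_subset)

lemma minimal_invariant_image:
  fixes B :: "real^'d^'d"
  assumes B: "invertible B" and conj: "\<And>g. g \<in> \<Gamma> \<Longrightarrow> \<exists>h\<in>\<Gamma>. g ** B = B ** h"
    and U: "minimal_invariant \<Gamma> U"
  shows "minimal_invariant \<Gamma> ((*v) B ` U)"
proof -
  have "subspace ((*v) B ` U)"
    using minimal_invariantD(2)[OF U] by (intro linear_subspace_image) auto
  moreover have "g *v (B *v x) \<in> (*v) B ` U" if gx: "g \<in> \<Gamma>" "x \<in> U" for g x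
  proof -
    obtain h where h: "h \<in> \<Gamma>" "g ** B = B ** h" using conj[OF gx(1)] by blast
    have "h *v x \<in> U" using h minimal_invariantD(1)[OF U] gx by (auto simp: invariant_def)
    then show ?thesis using h by (simp add: matrix_vector_mul_assoc) (simp flip: matrix_vector_mul_assoc)
  qed
  moreover have "(*v) B ` U \<noteq> {0}"
  proof
    assume "(*v) B ` U = {0}"
    then have "x = 0" if "x \<in> U" for x
      using that injD[OF invertible_inj[OF B], of x 0] by auto
    then show False
      using minimal_invariantD(2,3)[OF U] subspace_0 by blast
  qed
  ultimately show ?thesis
    using U by (auto simp: minimal_invariant_def invariant_def dim_image_invertible[OF B])
qed

text \<open>The intertwining matrix M is conjugated by B; the relation g B = B h turns commutation
  with h on U into commutation with g on the image.\<close>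

lemma embeds_image:
  fixes B :: "real^'d^'d"
  assumes B: "invertible B" and conj: "\<And>g. g \<in> \<Gamma> \<Longrightarrow> \<exists>h\<in>\<Gamma>. g ** B = B ** h"
    and U: "invariant \<Gamma> U" and emb: "embeds \<Gamma> U V"
  shows "embeds \<Gamma> ((*v) B ` U) ((*v) B ` V)"
proof -
  obtain M :: "real^'d^'d" where M: "inj_on ((*v) M) U" "(*v) M ` U \<subseteq> V"
      "\<And>g x. g \<in> \<Gamma> \<Longrightarrow> x \<in> U \<Longrightarrow> M *v (g *v x) = g *v (M *v x)"
    using emb unfolding embeds_def by blast
  obtain C where C: "C ** B = mat 1"
    using B by (auto simp: invertible_def)
  define N where "N = B ** M ** C"
  have N: "N *v (B *v x) = B *v (M *v x)" for x
  proof -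
    have "C *v (B *v x) = x" using C by (simp add: matrix_vector_mul_assoc)
    then show ?thesis by (simp add: N_def flip: matrix_vector_mul_assoc)
  qed
  have "inj_on ((*v) N) ((*v) B ` U)"
    using M(1) injD[OF invertible_inj[OF B]] by (auto simp: inj_on_def N)
  moreover have "(*v) N ` (*v) B ` U \<subseteq> (*v) B ` V"
    using M(2) by (auto simp: N)
  moreover have "N *v (g *v (B *v x)) = g *v (N *v (B *v x))" if gx: "g \<in> \<Gamma>" "x \<in> U" for g x
  proof -
    obtain h where h: "h \<in> \<Gamma>" "g ** B = B ** h" using conj[OF gx(1)] by blast
    have gB: "g *v (B *v y) = B *v (h *v y)" for y
      using h(2) by (simp add: matrix_vector_mul_assoc)
    show ?thesis using M(3)[OF h(1) gx(2)] by (simp add: gB N)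
  qed
  ultimately show ?thesis
    unfolding embeds_def by (intro exI[of _ N]) auto
qed

lemma dim_span_insert_minimal:
  fixes W :: "nat \<Rightarrow> (real^'d) set"
  assumes W: "\<And>k. minimal_invariant \<Gamma> (W k)" and "\<not> W n \<subseteq> span (\<Union>k\<in>N. W k)"
  shows "dim (span (\<Union>k\<in>insert n N. W k)) = dim (W n) + dim (span (\<Union>k\<in>N. W k))"
proof -
  let ?T = "span (\<Union>k\<in>N. W k)"
  have "invariant \<Gamma> ?T"
    by (intro invariant_span_Union minimal_invariantD(1)[OF W])
  then have "W n \<inter> ?T = {0}"
    using minimal_invariant_Int[OF W[of n]] assms(2) by blast
  moreover have "span (W n) = W n"
    using minimal_invariantD(2)[OF W] by (rule span_eq_iff[THEN iffD2])
  then have "span (\<Union>k\<in>insert n N. W k) = {x + y |x y. x \<in> W n \<and> y \<in> ?T}"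
    by (simp only: UN_insert span_Un)
  ultimately show ?thesis
    using dim_sums_Int[OF minimal_invariantD(2)[OF W[of n]] subspace_span[of "\<Union>k\<in>N. W k"]]
    by simp
qed

text \<open>The embedding is assembled from three facts: W (q + k) embeds into W k, hence W (n q)
  into W 0; and the W (n q) span everything, hence W j embeds into one of them.\<close>

lemma cyclic_embeds:
  fixes W :: "nat \<Rightarrow> (real^'d) set" and B :: "real^'d^'d"
  assumes B: "invertible B" and conj: "\<And>g. g \<in> \<Gamma> \<Longrightarrow> \<exists>h\<in>\<Gamma>. g ** B = B ** h"
    and W0: "minimal_invariant \<Gamma> (W 0)" and WSuc: "\<And>k. W (Suc k) = (*v) B ` W k"
    and irr: "\<And>q. 0 < q \<Longrightarrow> q dvd CARD('d) \<Longrightarrow> span (\<Union>k. W (k * q)) = UNIV"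
  shows "embeds \<Gamma> (W j) (W 0)"
proof -
  have W: "minimal_invariant \<Gamma> (W k)" for k
    by (induction k) (auto simp: W0 WSuc intro: minimal_invariant_image[OF B conj])
  have inv: "invariant \<Gamma> (W k)" for k
    by (rule minimal_invariantD(1)[OF W])
  define T where "T n = span (\<Union>k<n. W k)" for n
  define m where "m = dim (W 0)"
  have dimW: "dim (W k) = m" for k
    by (induction k) (auto simp: m_def WSuc dim_image_invertible[OF B])
  have "W 0 \<noteq> {}" "W 0 \<noteq> {0}"
    using minimal_invariantD[OF W0] subspace_0 by auto
  then have m: "m \<noteq> 0"
    unfolding m_def dim_eq_0 by blast
  \<comment> \<open>As long as no W k lies in the sum of its predecessors, the sum is
    direct.\<close>
  have dimT: "dim (T n) = n * m" if "\<And>k. k < n \<Longrightarrow> \<not> W k \<subseteq> T k" for n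
    using that
  proof (induction n)
    case 0
    then show ?case by (simp add: T_def)
  next
    case (Suc n)
    have "dim (T (Suc n)) = dim (W n) + dim (T n)"
      using dim_span_insert_minimal[OF W, where n = n and N = "{..<n}"] Suc.prems[of n]
      by (simp add: T_def lessThan_Suc)
    then show ?case using Suc by (simp add: dimW)
  qed
  \<comment> \<open>Otherwise d + 1 subspaces of dimension m \<ge> 1 would form a direct sum inside
    a d-dimensional space.\<close>
  have "\<exists>q. W q \<subseteq> T q"
  proof (rule ccontr)
    assume "\<not> ?thesis"
    then have "dim (T (Suc CARD('d))) = Suc CARD('d) * m" by (intro dimT) auto
    then show False
      using dim_subset_UNIV[of "T (Suc CARD('d))"] m by (cases m) auto
  qed
  then obtain q where q: "W q \<subseteq> T q" and least: "\<And>k. k < q \<Longrightarrow> \<not> W k \<subseteq> T k"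
    using exists_least_iff[of "\<lambda>q. W q \<subseteq> T q"] by blast
  have q0: "0 < q"
    using q \<open>W 0 \<noteq> {0}\<close> \<open>W 0 \<noteq> {}\<close> by (cases q) (auto simp: T_def)
  have WT: "W k \<subseteq> T q" for k
  proof (induction k)
    case 0
    then show ?case unfolding T_def using q0 span_superset[of "\<Union>k<q. W k"] by blast
  next
    case (Suc k)
    \<comment> \<open>B shifts the summands by one, and the last image W q falls back into T q by
      the choice of q.\<close>
    have "B *v x \<in> T q" if "x \<in> T q" for x
    proof -
      have "x \<in> {x. B *v x \<in> T q}"
        using that unfolding T_def
      proof (rule span_subspace_induct)
        show "subspace {x. B *v x \<in> span (\<Union>k<q. W k)}"
          by (auto simp: subspace_def matrix_vector_right_distrib matrix_vector_mult_scaleR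
              span_zero span_add span_scale)
        fix x assume "x \<in> (\<Union>k<q. W k)"
        then obtain k where k: "k < q" "x \<in> W k" by blast
        then have x: "B *v x \<in> W (Suc k)" by (simp add: WSuc)
        show "x \<in> {x. B *v x \<in> span (\<Union>k<q. W k)}"
        proof (cases "Suc k = q")
          case True
          then show ?thesis using x q by (auto simp: T_def)
        next
          case False
          then have "Suc k < q" using k by simp
          then show ?thesis using x by (auto intro!: span_base)
        qed
      qed
      then show ?thesis by simp
    qed
    then show ?case using Suc.IH by (auto simp: WSuc)
  qed
  \<comment> \<open>This is the spanning hypothesis for the divisor 1; with \<open>dimT\<close> it
    gives d = q m, so that the hypothesis also applies to q.\<close>
  have full: "T q = UNIV"
  proof -
    have "span (\<Union>k. W (k * 1)) = UNIV" by (rule irr) auto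
    moreover have "span (\<Union>k. W (k * 1)) \<subseteq> T q"
      using WT unfolding T_def by (intro span_minimal) auto
    ultimately show ?thesis by blast
  qed
  then have "q dvd CARD('d)"
    using dimT[of q] least by (simp add: dim_UNIV)
  then have irrq: "span (\<Union>k. W (k * q)) = UNIV"
    by (rule irr[OF q0])
  have emb_q: "embeds \<Gamma> (W q) (W 0)"
  proof -
    let ?S = "span (\<Union>k\<in>{1..<q}. W k)"
    have S: "invariant \<Gamma> ?S" by (rule invariant_span_Union) (rule inv)
    \<comment> \<open>Seeing the complement as a B-image lets an inclusion of W q in it be pulled
      back to one of W (q - 1) in T (q - 1), against the minimality of q.\<close>
    have S_eq: "?S = (*v) B ` T (q - 1)"
    proof -
      have "{1..<q} = Suc ` {..<q - 1}"
        using q0 by (auto simp: image_Suc_lessThan)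
      then have "(\<Union>k\<in>{1..<q}. W k) = (*v) B ` (\<Union>k<q - 1. W k)"
        by (auto simp: WSuc)
      then show ?thesis
        by (simp add: T_def linear_span_image)
    qed
    have "{..<q} = insert 0 {1..<q}" using q0 by auto
    then have sum: "\<exists>s\<in>?S. \<exists>y\<in>W 0. x = s + y" for x
      using span_insert_sum[of W 0 x "{1..<q}"] full minimal_invariantD(2)[OF W0]
      by (auto simp: T_def)
    have "\<not> W q \<subseteq> ?S"
    proof
      assume "W q \<subseteq> ?S"
      then have "(*v) B ` W (q - 1) \<subseteq> (*v) B ` T (q - 1)"
        unfolding S_eq using WSuc[of "q - 1"] q0 by simp
      then have "W (q - 1) \<subseteq> T (q - 1)"
        using invertible_inj[OF B] by (simp add: inj_image_subset_iff)
      then show False using least[of "q - 1"] q0 by simp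
    qed
    then have q_S: "W q \<inter> ?S = {0}"
      using minimal_invariant_Int[OF W S] by blast
    \<comment> \<open>Otherwise the sum of both, which is the whole space, would equal
      \<open>?S\<close> and contain W q.\<close>
    have "\<not> W 0 \<subseteq> ?S"
    proof
      assume "W 0 \<subseteq> ?S"
      then have "x \<in> ?S" for x
        using sum[of x] by (auto intro: span_add)
      then show False using \<open>\<not> W q \<subseteq> ?S\<close> by blast
    qed
    then have "W 0 \<inter> ?S = {0}"
      using minimal_invariant_Int[OF W S] by blast
    then show ?thesis
      using embeds_along[OF inv inv S q_S] sum by blast
  qed
  have emb_shift: "embeds \<Gamma> (W (q + k)) (W k)" for k
    by (induction k) (auto simp: emb_q WSuc intro: embeds_image[OF B conj inv])
  have emb_mult: "embeds \<Gamma> (W (n * q)) (W 0)" for n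
    by (induction n) (auto simp: embeds_refl intro: embeds_trans[OF emb_shift])
  have "\<exists>k\<in>UNIV. embeds \<Gamma> (W j) (W (k * q))"
    using irrq by (intro embeds_summand[OF W W]) auto
  then show ?thesis
    using embeds_trans[OF _ emb_mult] by blast
qed

section \<open>Scalar action on an exterior power\<close>

text \<open>The wedge w k of a basis of W k spans a line preserved by g. Embeddings into W 0 show
  that the eigenvalues agree, and the family F moves each line into the next, so irreducibility
  makes the lines span the exterior power.\<close>

lemma exterior_map_scalar:
  fixes W :: "nat \<Rightarrow> (real^'d) set" and F :: "(real^'d^'d) set"
  assumes inv: "\<And>k. invariant \<Gamma> (W k)" and dim: "\<And>k. dim (W k) = m"
    and emb: "\<And>k. embeds \<Gamma> (W k) (W 0)"
    and F: "\<And>f k. f \<in> F \<Longrightarrow> (*v) f ` W k \<subseteq> W (Suc k)"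
    and irr: "irreducible_family (exterior_power m :: (real^('d set)) set) (exterior_map m ` F)"
    and g: "g \<in> \<Gamma>"
  obtains c where "\<And>v. wedge m (\<lambda>i. g *v v i) = c *\<^sub>R wedge m v"
proof -
  have "\<exists>e. inj_on e {..<m} \<and> independent (e ` {..<m}) \<and> span (e ` {..<m}) = W k" for k
  proof -
    obtain C where C: "C \<subseteq> W k" "independent C" "W k \<subseteq> span C" "card C = m"
      using basis_exists[of "W k"] dim by metis
    then obtain e where "bij_betw e {..<m} C"
      using ex_bij_betw_nat_finite[of C] independent_imp_finite by (auto simp: atLeast0LessThan)
    moreover have "span C = W k"
      using C inv[of k] span_minimal[of C "W k"] by (auto simp: invariant_def)
    ultimately show ?thesis using C by (intro exI[of _ e]) (auto simp: bij_betw_def)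
  qed
  then obtain e where e: "\<And>k. inj_on (e k) {..<m}" "\<And>k. independent (e k ` {..<m})"
      "\<And>k. span (e k ` {..<m}) = W k"
    by metis
  have eW: "e k i \<in> W k" if "i < m" for k i
    using that span_superset[of "e k ` {..<m}"] by (auto simp: e(3))
  define w where "w k = wedge m (e k)" for k
  have w0: "w k \<noteq> 0" for k
    unfolding w_def by (rule wedge_nonzero[OF e(1,2)])
  have wedge_W: "\<exists>c. wedge m x = c *\<^sub>R w k" if "\<And>i. i < m \<Longrightarrow> x i \<in> W k" for x k
    using wedge_in_span[OF e(1,2)[of k], of x] that by (auto simp: e(3) w_def)
  have "\<exists>c. exterior_map m g (w k) = c *\<^sub>R w k" for k
    unfolding w_def[of k] exterior_map_wedge
    by (subst w_def[symmetric]) (intro wedge_W, use eW inv[of k] g in \<open>auto simp: invariant_def\<close>)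
  then obtain c where c: "\<And>k. exterior_map m g (w k) = c k *\<^sub>R w k" by metis
  have c0: "c k = c 0" for k
  proof -
    obtain M :: "real^'d^'d" where M: "inj_on ((*v) M) (W k)" "(*v) M ` W k \<subseteq> W 0"
        "\<And>x. x \<in> W k \<Longrightarrow> M *v (g *v x) = g *v (M *v x)"
      using emb[of k] g unfolding embeds_def by blast
    let ?f = "\<lambda>i. M *v e k i"
    obtain b where b: "wedge m ?f = b *\<^sub>R w 0"
      using wedge_W[of ?f 0] eW M(2) by blast
    have "inj_on ((*v) M) (span (e k ` {..<m}))"
      using M(1) by (simp add: e(3))
    then have "independent ((*v) M ` e k ` {..<m})"
      
      by (intro linear_independent_injective_image e(2)) auto
    moreover have "inj_on ?f {..<m}"
      using e(1)[of k] M(1) eW by (auto simp: inj_on_def)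
    ultimately have "wedge m ?f \<noteq> 0"
      by (intro wedge_nonzero) (auto simp: image_image)
    then have b0: "b \<noteq> 0" using b by auto
    \<comment> \<open>The wedge of the vectors M (g e) is computed twice: through W 0 it carries the
      eigenvalue c 0, through W k the eigenvalue c k.\<close>
    have "(c 0 * b) *\<^sub>R w 0 = exterior_map m g (wedge m ?f)"
      by (simp add: b c linear_cmul[OF linear_exterior_map])
    also have "\<dots> = wedge m (\<lambda>i. M *v (g *v e k i))"
      unfolding exterior_map_wedge using M(3) eW by (intro wedge_cong) simp
    also have "\<dots> = exterior_map m M (exterior_map m g (w k))"
      by (simp add: w_def exterior_map_wedge)
    also have "\<dots> = c k *\<^sub>R wedge m ?f"
      by (simp add: c linear_cmul[OF linear_exterior_map]) (simp add: w_def exterior_map_wedge)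
    finally show ?thesis using b b0 w0[of 0] by simp
  qed
  define V where "V = span (range w)"
  have "V = exterior_power m"
  proof (rule ccontr)
    assume ne: "V \<noteq> exterior_power m"
    have "V \<subseteq> exterior_power m"
      unfolding V_def exterior_power_def by (intro span_mono) (auto simp: w_def)
    moreover have "V \<noteq> {0}"
      using w0[of 0] span_base[of "w 0" "range w"] by (auto simp: V_def)
    moreover have "exterior_map m f ` V \<subseteq> V" if "f \<in> F" for f
    proof -
      have "exterior_map m f (w k) \<in> V" for k
      proof -
        have "\<exists>a. exterior_map m f (w k) = a *\<^sub>R w (Suc k)"
          unfolding w_def[of k] exterior_map_wedge
          by (intro wedge_W) (use eW F[OF that] in blast)
        then obtain a where "exterior_map m f (w k) = a *\<^sub>R w (Suc k)" ..
        moreover have "w (Suc k) \<in> span (range w)" by (intro span_base) simp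
        ultimately show ?thesis by (simp add: V_def span_scale)
      qed
      then have "exterior_map m f ` range w \<subseteq> V" by auto
      then show ?thesis
        unfolding V_def linear_span_image[OF linear_exterior_map, symmetric]
        by (intro span_minimal) auto
    qed
    ultimately show False
      using irr ne unfolding irreducible_family_def V_def by blast
  qed
  moreover have "exterior_map m g x = c 0 *\<^sub>R x" if "x \<in> V" for x
  proof -
    have "x \<in> {x. exterior_map m g x = c 0 *\<^sub>R x}"
      using that unfolding V_def
    proof (rule span_subspace_induct)
      show "subspace {x. exterior_map m g x = c 0 *\<^sub>R x}"
        using linear_exterior_map[of m g]
        by (auto simp: subspace_def linear_0 linear_add linear_cmul scaleR_add_right)
    qed (use c c0 in auto)
    then show ?thesis by simp
  qed
  moreover have "wedge m v \<in> exterior_power m" for v :: "nat \<Rightarrow> real^'d"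
    by (auto simp: exterior_power_def intro: span_base)
  ultimately have "wedge m (\<lambda>i. g *v v i) = c 0 *\<^sub>R wedge m v" for v
    by (simp flip: exterior_map_wedge)
  then show thesis by (rule that)
qed

section \<open>Operator norms\<close>

lemma norm_le_onorm_matrix:
  fixes X :: "real^'d^'d"
  shows "norm X \<le> real CARD('d) * real CARD('d) * onorm ((*v) X)"
proof -
  have "norm X \<le> (\<Sum>i\<in>UNIV. norm (X $ i))"
    by (simp add: norm_vec_def L2_set_le_sum)
  also have "\<dots> \<le> (\<Sum>i\<in>(UNIV :: 'd set). real CARD('d) * onorm ((*v) X))"
  proof (rule sum_mono)
    fix i
    have "norm (X $ i) \<le> (\<Sum>j\<in>UNIV. \<bar>X $ i $ j\<bar>)"
      by (rule norm_le_l1_cart)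
    also have "\<dots> \<le> (\<Sum>j\<in>(UNIV :: 'd set). onorm ((*v) X))"
      by (intro sum_mono matrix_component_le_onorm)
    finally show "norm (X $ i) \<le> real CARD('d) * onorm ((*v) X)"
      by simp
  qed
  finally show ?thesis by simp
qed

lemma onorm_le_norm_matrix:
  fixes X :: "real^'d^'d"
  shows "onorm ((*v) X) \<le> real CARD('d) * real CARD('d) * norm X"
proof (rule onorm_le_matrix_component)
  fix i j
  have "\<bar>X $ i $ j\<bar> \<le> norm (X $ i)" by (rule component_le_norm_cart)
  also have "\<dots> \<le> norm X" by (rule Finite_Cartesian_Product.norm_nth_le)
  finally show "\<bar>X $ i $ j\<bar> \<le> norm X" .
qed

text \<open>By Schur's lemma the nonzero elements of the commutant are invertible, so \<open>X ** Y\<close> does not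
  vanish on the product of two unit spheres of the commutant.\<close>

lemma commutant_onorm_mult:
  fixes F :: "(real^'d^'d) set"
  assumes irr: "irreducible_family UNIV ((*v) ` F)"
  obtains c where "c > 0"
    "\<And>X Y. (\<And>B. B \<in> F \<Longrightarrow> X ** B = B ** X) \<Longrightarrow> (\<And>B. B \<in> F \<Longrightarrow> Y ** B = B ** Y) \<Longrightarrow>
       c * onorm ((*v) X) * onorm ((*v) Y) \<le> onorm ((*v) (X ** Y))"
proof -
  define C where "C = {X. \<forall>B\<in>F. X ** B = B ** X}"
  define S where "S = C \<inter> sphere 0 1"
  have nz: "X ** Y \<noteq> 0" if "X \<in> C" "X \<noteq> 0" "Y \<noteq> 0" for X Y
  proof
    assume XY: "X ** Y = 0"
    let ?K = "{x. X *v x = 0}"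
    have "subspace ?K"
      by (auto simp: subspace_def matrix_vector_right_distrib matrix_vector_mult_scaleR)
    moreover have "(*v) B ` ?K \<subseteq> ?K" if B: "B \<in> F" for B
    proof -
      have "X *v (B *v x) = B *v (X *v x)" for x
        using \<open>X \<in> C\<close> B by (simp add: C_def matrix_vector_mul_assoc)
      then show ?thesis by auto
    qed
    moreover have "?K \<noteq> UNIV"
      using \<open>X \<noteq> 0\<close> by (auto simp: matrix_eq)
    ultimately have K: "?K = {0}"
      using irr unfolding irreducible_family_def by blast
    have "Y *v x = 0" for x
    proof -
      have "X *v (Y *v x) = 0" using XY by (simp add: matrix_vector_mul_assoc)
      then show ?thesis using K by auto
    qed
    then show False using \<open>Y \<noteq> 0\<close> by (simp add: matrix_eq)
  qed
  have closed: "closed C"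
  proof -
    have "C = (\<Inter>B\<in>F. {X. X ** B = B ** X})" by (auto simp: C_def)
    moreover have "closed {X. X ** B = B ** X}" for B :: "real^'d^'d"
      unfolding matrix_matrix_mult_def by (intro closed_Collect_eq continuous_intros)
    ultimately show ?thesis by auto
  qed
  have comp: "compact (S \<times> S)"
    unfolding S_def using closed by (intro compact_Times closed_Int_compact) auto
  have cont: "continuous_on (S \<times> S) (\<lambda>p. norm (fst p ** snd p))"
    unfolding matrix_matrix_mult_def by (intro continuous_intros)
  have "\<exists>\<delta>>0. \<forall>X\<in>S. \<forall>Y\<in>S. \<delta> \<le> norm (X ** Y)"
  proof (cases "S = {}")
    case True
    then show ?thesis by (intro exI[of _ 1]) auto
  next
    case False
    then obtain p where p: "p \<in> S \<times> S" "\<forall>q\<in>S \<times> S. norm (fst p ** snd p) \<le> norm (fst q ** snd q)"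
      using continuous_attains_inf[OF comp _ cont] by blast
    have "fst p \<in> C" "fst p \<noteq> 0" "snd p \<noteq> 0"
      using p(1) by (auto simp: S_def)
    then have "0 < norm (fst p ** snd p)" using nz by simp
    then show ?thesis using p(2) by (intro exI[of _ "norm (fst p ** snd p)"]) auto
  qed
  then obtain \<delta> where \<delta>: "\<delta> > 0" "\<And>X Y. X \<in> S \<Longrightarrow> Y \<in> S \<Longrightarrow> \<delta> \<le> norm (X ** Y)"
    by blast
  \<comment> \<open>The commutant is closed under scaling, so the bound on unit spheres extends to
    all its elements by homogeneity.\<close>
  have scale: "(1 / norm X) *\<^sub>R X \<in> S" if "X \<in> C" "X \<noteq> 0" for X
    using that by (auto simp: S_def C_def matrix_scalar_ac simp flip: scalar_matrix_assoc)
  have mult: "\<delta> * norm X * norm Y \<le> norm (X ** Y)" if "X \<in> C" "Y \<in> C" for X Y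
  proof (cases "X = 0 \<or> Y = 0")
    case False
    have "\<delta> \<le> norm ((1 / norm X) *\<^sub>R X ** (1 / norm Y) *\<^sub>R Y)"
      using \<delta>(2)[OF scale scale] that False by simp
    also have "\<dots> = norm (X ** Y) / (norm X * norm Y)"
      by (simp add: scalar_matrix_assoc[symmetric] matrix_scalar_ac)
    finally show ?thesis using False by (simp add: field_simps)
  qed auto
  define D where "D = real CARD('d) * real CARD('d)"
  have D: "D > 0" by (simp add: D_def)
  show thesis
  proof
    \<comment> \<open>Each of the three comparisons between \<open>norm\<close> and
      \<open>onorm\<close> costs a factor D.\<close>
    show "\<delta> / (D * D * D) > 0" using \<delta> D by simp
    fix X Y :: "real^'d^'d"
    assume "\<And>B. B \<in> F \<Longrightarrow> X ** B = B ** X" "\<And>B. B \<in> F \<Longrightarrow> Y ** B = B ** Y"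
    then have XY: "X \<in> C" "Y \<in> C" by (auto simp: C_def)
    have "\<delta> * (onorm ((*v) X) * onorm ((*v) Y)) \<le> \<delta> * ((D * norm X) * (D * norm Y))"
      using \<delta>(1) D onorm_le_norm_matrix[of X] onorm_le_norm_matrix[of Y]
      by (intro mult_left_mono mult_mono) (auto simp: D_def onorm_pos_le)
    also have "\<dots> = D * D * (\<delta> * norm X * norm Y)" by simp
    also have "\<dots> \<le> D * D * norm (X ** Y)"
      using mult[OF XY] D by (intro mult_left_mono) auto
    also have "\<dots> \<le> D * D * (D * onorm ((*v) (X ** Y)))"
      using norm_le_onorm_matrix[of "X ** Y"] D by (intro mult_left_mono) (auto simp: D_def)
    finally show "\<delta> / (D * D * D) * onorm ((*v) X) * onorm ((*v) Y) \<le> onorm ((*v) (X ** Y))"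
      using D by (simp add: field_simps)
  qed
qed

section \<open>Word products and compactness of the unit sphere\<close>

lemma word_prod_append: "word_prod A (u @ v) = word_prod A v ** word_prod A u"
  by (induction u) (auto simp: matrix_mul_assoc)

lemma finite_words: "finite (words l k)"
  using finite_lists_length_eq[of "{1..l}" k] by (simp add: words_def conj_commute)

lemma mult_onorm_le:
  fixes f :: "'a::{real_normed_vector, perfect_space} \<Rightarrow> 'b::real_normed_vector"
  assumes "bounded_linear f" "0 \<le> a" "\<And>x. a * norm (f x) \<le> b * norm x"
  shows "a * onorm f \<le> b"
proof -
  have "onorm (\<lambda>x. a *\<^sub>R f x) \<le> b"
    using assms(2,3) by (intro onorm_le) simp
  then show ?thesis
    using onorm_scaleR[OF assms(1), of a] assms(2) by simp
qed

text \<open>The squared length of A z is the inner product of the transpose applied to A z with z.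
  The bound is needed because J is moved to the other side of an inner product below.\<close>

lemma onorm_le_transpose:
  fixes A :: "real^'n^'m"
  shows "onorm ((*v) A) \<le> onorm ((*v) (transpose A))"
proof (rule onorm_le)
  fix z
  have "norm (A *v z) * norm (A *v z) = (A *v z) \<bullet> (A *v z)"
    by (simp add: power2_norm_eq_inner flip: power2_eq_square)
  also have "\<dots> = (transpose A *v (A *v z)) \<bullet> z"
    by (simp add: dot_lmul_matrix transpose_matrix_vector)
  also have "\<dots> \<le> norm (transpose A *v (A *v z)) * norm z"
    by (rule norm_cauchy_schwarz)
  also have "\<dots> \<le> onorm ((*v) (transpose A)) * norm (A *v z) * norm z"
    by (intro mult_right_mono onorm) (auto simp del: transpose_matrix_vector)
  finally have "norm (A *v z) * norm (A *v z) \<le> norm (A *v z) * (onorm ((*v) (transpose A)) * norm z)"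
    by (simp add: mult_ac)
  then show "norm (A *v z) \<le> onorm ((*v) (transpose A)) * norm z"
    by (cases "A *v z = 0") (auto simp: onorm_pos_le)
qed

text \<open>The sum over K of |<v, A_K u>| is positive for nonzero u and v, as no nonzero v is
  orthogonal to a spanning set. Compactness gives a lower bound \<delta> |u| |v|. It is applied to u
  = A_I x and v = the transpose of A_J applied to y, where the inner products become <y, A_{IKJ}
  x>.\<close>

lemma spanning_imp_quasi_multiplicative:
  fixes A :: "nat \<Rightarrow> real^'d^'d"
  assumes span: "\<And>u. u \<noteq> 0 \<Longrightarrow> span ((\<lambda>K. word_prod A K *v u) ` words l k) = UNIV"
  shows "quasi_multiplicative l A k"
proof -
  define f where "f p = (\<Sum>K\<in>words l k. \<bar>snd p \<bullet> (word_prod A K *v fst p)\<bar>)" for p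
  have pos: "0 < f (u, v)" if "u \<noteq> 0" "v \<noteq> 0" for u v
  proof (rule ccontr)
    assume "\<not> ?thesis"
    then have "f (u, v) = 0"
      unfolding f_def by (simp add: sum_nonneg order_antisym not_less)
    then have 0: "v \<bullet> (word_prod A K *v u) = 0" if "K \<in> words l k" for K
      using that finite_words by (simp add: f_def sum_nonneg_eq_0_iff)
    have "orthogonal v v"
      using span[OF that(1)] 0
      by (intro orthogonal_to_span[of v "(\<lambda>K. word_prod A K *v u) ` words l k"])
        (auto simp: orthogonal_def)
    then show False using that by (simp add: orthogonal_def)
  qed
  let ?S = "sphere 0 1 :: (real^'d) set"
  have "continuous_on (?S \<times> ?S) f"
    unfolding f_def
    by (intro continuous_intros bounded_linear.continuous_on[OF matrix_vector_mul_bounded_linear])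
  moreover have "compact (?S \<times> ?S)" by (intro compact_Times) auto
  moreover have "(axis undefined 1, axis undefined 1) \<in> ?S \<times> ?S"
    by simp
  ultimately obtain p where p: "p \<in> ?S \<times> ?S" "\<forall>q\<in>?S \<times> ?S. f p \<le> f q"
    using continuous_attains_inf[of "?S \<times> ?S" f] by blast
  define \<delta> where "\<delta> = f p"
  have "norm (fst p) = 1" "norm (snd p) = 1"
    using p(1) by (auto simp: mem_Times_iff)
  then have "fst p \<noteq> 0" "snd p \<noteq> 0"
    by (metis norm_zero zero_neq_one)+
  then have \<delta>: "0 < \<delta>"
    using pos[of "fst p" "snd p"] by (simp add: \<delta>_def)
  have f_ge: "\<delta> * norm u * norm v \<le> f (u, v)" for u v
  proof (cases "u = 0 \<or> v = 0")
    case False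
    have "\<delta> \<le> f ((1 / norm u) *\<^sub>R u, (1 / norm v) *\<^sub>R v)"
      unfolding \<delta>_def using False by (intro p(2)[rule_format]) auto
    also have "\<dots> = f (u, v) / (norm u * norm v)"
      by (simp add: f_def matrix_vector_mult_scaleR abs_mult sum_divide_distrib)
    finally show ?thesis using False by (simp add: field_simps)
  qed (auto simp: f_def sum_nonneg)
  define N where "N = real (card (words l k))"
  \<comment> \<open>An empty sum could not be positive.\<close>
  have "words l k \<noteq> {}"
    using pos[of "axis undefined 1" "axis undefined 1"] by (auto simp: f_def axis_eq_0_iff)
  then have N: "0 < N" using finite_words[of l k] by (simp add: N_def card_gt_0_iff)
  show ?thesis
    unfolding quasi_multiplicative_def
  proof (intro exI[of _ "\<delta> / N"] conjI ballI)
    show "0 < \<delta> / N" using \<delta> N by simp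
    fix I J
    define m where "m K = onorm ((*v) (word_prod A (I @ K @ J)))" for K
    \<comment> \<open>The chosen K maximises the norm of the product over I K J, so the sum of N
      terms is at most N times its value.\<close>
    have "Max (m ` words l k) \<in> m ` words l k"
      using finite_words \<open>words l k \<noteq> {}\<close> by (intro Max_in) auto
    then obtain K where K: "K \<in> words l k" "m K = Max (m ` words l k)"
      by auto
    have m_le: "m K' \<le> m K" if "K' \<in> words l k" for K'
      using that finite_words by (simp add: K(2))
    let ?I = "word_prod A I" and ?J = "transpose (word_prod A J)"
    have bound: "\<delta> * norm (?I *v x) * norm (?J *v y) \<le> N * m K * norm x * norm y" for x y
    proof -
      have "\<delta> * norm (?I *v x) * norm (?J *v y) \<le> f (?I *v x, ?J *v y)"
        by (rule f_ge)
      also have "\<dots> = (\<Sum>K'\<in>words l k. \<bar>y \<bullet> (word_prod A (I @ K' @ J) *v x)\<bar>)"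
        by (simp add: f_def word_prod_append dot_lmul_matrix transpose_matrix_vector
            matrix_vector_mul_assoc matrix_mul_assoc)
      also have "\<dots> \<le> (\<Sum>K'\<in>words l k. m K * norm x * norm y)"
      proof (rule sum_mono)
        fix K' assume "K' \<in> words l k"
        have "\<bar>y \<bullet> (word_prod A (I @ K' @ J) *v x)\<bar> \<le> norm y * norm (word_prod A (I @ K' @ J) *v x)"
          by (rule Cauchy_Schwarz_ineq2)
        also have "\<dots> \<le> norm y * (m K' * norm x)"
          unfolding m_def by (intro mult_left_mono onorm) auto
        also have "\<dots> \<le> norm y * (m K * norm x)"
          using m_le[OF \<open>K' \<in> words l k\<close>] by (intro mult_left_mono mult_right_mono) auto
        finally show "\<bar>y \<bullet> (word_prod A (I @ K' @ J) *v x)\<bar> \<le> m K * norm x * norm y"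
          by (simp add: mult_ac)
      qed
      finally show ?thesis by (simp add: N_def mult_ac)
    qed
    \<comment> \<open>The supremum is taken over x first and then, in the next step, over y.\<close>
    have I: "\<delta> * norm (?J *v y) * onorm ((*v) ?I) \<le> N * m K * norm y" for y
      using \<delta> bound[of _ y] by (intro mult_onorm_le) (auto simp: mult_ac)
    have J: "\<delta> * onorm ((*v) ?I) * onorm ((*v) ?J) \<le> N * m K"
      using \<delta> I by (intro mult_onorm_le) (auto simp: mult_ac onorm_pos_le)
    have "\<delta> * onorm ((*v) ?I) * onorm ((*v) (word_prod A J)) \<le> \<delta> * onorm ((*v) ?I) * onorm ((*v) ?J)"
      using \<delta> onorm_le_transpose by (intro mult_left_mono) (auto simp: onorm_pos_le)
    then have "\<delta> / N * onorm ((*v) ?I) * onorm ((*v) (word_prod A J)) \<le> m K"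
      using J N by (simp add: field_simps)
    then show "\<exists>K\<in>words l k. \<delta> / N * onorm ((*v) ?I) * onorm ((*v) (word_prod A J))
        \<le> onorm ((*v) (word_prod A (I @ K @ J)))"
      using K(1) by (auto simp: m_def)
  qed
qed

text \<open>The unit vectors whose length-k images fail to span form nonempty compact sets
  decreasing in k, which have a common point.\<close>

lemma common_nonspanning_vector:
  fixes A :: "nat \<Rightarrow> real^'d^'d"
  assumes l: "1 \<le> l" and inv: "\<And>i. i \<in> {1..l} \<Longrightarrow> invertible (A i)"
    and ex: "\<And>k. 1 \<le> k \<Longrightarrow> \<exists>u. u \<noteq> 0 \<and> span ((\<lambda>K. word_prod A K *v u) ` words l k) \<noteq> UNIV"
  obtains u where "u \<noteq> 0" "\<And>k. span ((\<lambda>K. word_prod A K *v u) ` words l k) \<noteq> UNIV"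
proof -
  define V where "V k u = span ((\<lambda>K. word_prod A K *v u) ` words l k)" for k u
  define F where "F k = {u \<in> sphere 0 1. V k u \<noteq> UNIV}" for k
  \<comment> \<open>A unit normal vector witnesses that the span is proper; this makes
    \<open>F k\<close> the projection of a compact set of pairs.\<close>
  have orth: "V k u \<noteq> UNIV \<longleftrightarrow> (\<exists>v\<in>sphere 0 1. \<forall>K\<in>words l k. v \<bullet> (word_prod A K *v u) = 0)" for k u
  proof
    assume "V k u \<noteq> UNIV"
    then obtain a where a: "a \<noteq> 0" "\<And>x. x \<in> V k u \<Longrightarrow> a \<bullet> x = 0"
      unfolding V_def using span_not_UNIV_orthogonal by metis
    have "word_prod A K *v u \<in> V k u" if "K \<in> words l k" for K
      unfolding V_def using that by (intro span_base) auto
    then show "\<exists>v\<in>sphere 0 1. \<forall>K\<in>words l k. v \<bullet> (word_prod A K *v u) = 0"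
      using a by (intro bexI[of _ "(1 / norm a) *\<^sub>R a"]) auto
  next
    assume "\<exists>v\<in>sphere 0 1. \<forall>K\<in>words l k. v \<bullet> (word_prod A K *v u) = 0"
    then obtain v where v: "norm v = 1" "\<And>K. K \<in> words l k \<Longrightarrow> v \<bullet> (word_prod A K *v u) = 0"
      by auto
    show "V k u \<noteq> UNIV"
    proof
      assume "V k u = UNIV"
      then have "orthogonal v v"
        using v(2) unfolding V_def
        by (intro orthogonal_to_span[of v "(\<lambda>K. word_prod A K *v u) ` words l k"])
          (auto simp: orthogonal_def)
      then show False using v(1) by (auto simp: orthogonal_def)
    qed
  qed
  have comp: "compact (F k)" for k
  proof -
    let ?G = "(sphere 0 1 \<times> sphere 0 1) \<inter>
      (\<Inter>K\<in>words l k. {p :: (real^'d) \<times> (real^'d). snd p \<bullet> (word_prod A K *v fst p) = 0})"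
    have "F k = fst ` ?G"
      unfolding F_def orth by force
    moreover have "closed {p :: (real^'d) \<times> (real^'d). snd p \<bullet> (word_prod A K *v fst p) = 0}" for K
      by (intro closed_Collect_eq continuous_intros bounded_linear.continuous_on[OF matrix_vector_mul_bounded_linear])
    then have "compact ?G"
      by (intro compact_Int_closed compact_Times closed_INT) auto
    then have "compact (fst ` ?G)"
      by (intro compact_continuous_image continuous_intros)
    ultimately show ?thesis by simp
  qed
  \<comment> \<open>Appending the letter 1 applies the surjective matrix A 1 to the span.\<close>
  have step: "V (Suc k) u = UNIV" if "V k u = UNIV" for k u
  proof -
    have one: "1 \<in> {1..l}" using l by simp
    have "(*v) (A 1) ` ((\<lambda>K. word_prod A K *v u) ` words l k) \<subseteq> (\<lambda>K. word_prod A K *v u) ` words l (Suc k)"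
    proof (clarify)
      fix K assume "K \<in> words l k"
      then have "K @ [1] \<in> words l (Suc k)" using one by (auto simp: words_def)
      moreover have "A 1 *v (word_prod A K *v u) = word_prod A (K @ [1]) *v u"
        by (simp add: word_prod_append matrix_vector_mul_assoc)
      ultimately show "A 1 *v (word_prod A K *v u) \<in> (\<lambda>K. word_prod A K *v u) ` words l (Suc k)"
        by blast
    qed
    then have "(*v) (A 1) ` V k u \<subseteq> V (Suc k) u"
      unfolding V_def by (simp add: span_mono flip: linear_span_image)
    moreover have "surj ((*v) (A 1))"
      using inv[OF one] matrix_right_invertible_surjective by (auto simp: invertible_def)
    ultimately show ?thesis using that by auto
  qed
  have mono: "F n \<subseteq> F m" if "m \<le> n" for m n
    using that
  proof (induction rule: dec_induct)
    case (step n)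
    then show ?case using \<open>\<And>u k. V k u = UNIV \<Longrightarrow> V (Suc k) u = UNIV\<close> by (auto simp: F_def)
  qed simp
  have ne1: "F k \<noteq> {}" if k: "1 \<le> k" for k
  proof -
    obtain u where u: "u \<noteq> 0" "V k u \<noteq> UNIV" using ex[OF k] by (auto simp: V_def)
    then obtain v where v: "v \<in> sphere 0 1" "\<forall>K\<in>words l k. v \<bullet> (word_prod A K *v u) = 0"
      unfolding orth by blast
    have "(1 / norm u) *\<^sub>R u \<in> F k"
      using u(1) v unfolding F_def orth by (auto simp: matrix_vector_mult_scaleR)
    then show ?thesis by blast
  qed
  \<comment> \<open>Length 0, excluded from the hypothesis, is covered because
    \<open>F (Suc k)\<close> lies in \<open>F k\<close>.\<close>
  have "F k \<noteq> {}" for k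
    using ne1[of "Suc k"] mono[of k "Suc k"] by auto
  then have "\<Inter>(range F) \<noteq> {}"
    using comp mono by (intro compact_nest) auto
  then obtain u where "\<And>k. u \<in> F k" by blast
  then have "norm u = 1" "\<And>k. V k u \<noteq> UNIV"
    by (auto simp: F_def)
  then show thesis
    by (intro that[of u]) (auto simp: V_def)
qed

section \<open>Quasi-multiplicativity\<close>

definition quotient_matrix :: "(nat \<Rightarrow> real^'d^'d) \<Rightarrow> nat \<Rightarrow> nat list \<Rightarrow> real^'d^'d" where
  "quotient_matrix A a w = matrix_inv (word_prod A (replicate (length w) a)) ** word_prod A w"

lemma invertible_mat_1: "invertible (mat 1 :: real^'d^'d)"
  unfolding invertible_def by (intro exI[of _ "mat 1"]) simp

lemma invertible_word_prod:
  fixes A :: "nat \<Rightarrow> real^'d^'d"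
  assumes "\<And>i. i \<in> {1..l} \<Longrightarrow> invertible (A i)" "set w \<subseteq> {1..l}"
  shows "invertible (word_prod A w)"
  using assms(2) by (induction w) (auto simp: assms(1) invertible_mult invertible_mat_1)

lemma matrix_inv_mult:
  fixes B :: "real^'d^'d"
  assumes "invertible B"
  shows "B ** matrix_inv B = mat 1" "matrix_inv B ** B = mat 1"
  using someI_ex[OF assms[unfolded invertible_def]] by (auto simp: matrix_inv_def)

lemma word_prod_replicate:
  "word_prod A (replicate n i) *v x = (((*v) (A i)) ^^ n) x"
  by (induction n arbitrary: x) (simp_all add: funpow_swap1 flip: matrix_vector_mul_assoc)

lemma irreducible_familyD:
  assumes "irreducible_family UNIV F" "subspace V" "V \<noteq> {0}" "\<And>f. f \<in> F \<Longrightarrow> f ` V \<subseteq> V"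
  shows "V = UNIV"
  using assms unfolding irreducible_family_def by blast

section \<open>Quotients of word products by powers of one generator\<close>

context
  fixes l :: nat and A :: "nat \<Rightarrow> real^'d^'d" and a :: nat
  assumes a: "a \<in> {1..l}" and inv: "\<And>i. i \<in> {1..l} \<Longrightarrow> invertible (A i)"
begin

lemma invertible_power: "invertible (word_prod A (replicate n a))"
  using a by (intro invertible_word_prod[of l] inv) auto

lemma power_quotient:
  "word_prod A (replicate (length w) a) ** quotient_matrix A a w = word_prod A w"
  by (simp add: quotient_matrix_def matrix_mul_assoc matrix_inv_mult[OF invertible_power])

lemma power_quotient_vec:
  "word_prod A (replicate (length w) a) *v (quotient_matrix A a w *v x) = word_prod A w *v x"
  by (simp add: matrix_vector_mul_assoc power_quotient)

text \<open>Since the first letter acts first, A_w A_a is the product over the word a w; cancelling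
  powers of A a gives the identity. It supplies the relation g B = B h with B = A a.\<close>

lemma quotient_matrix_commute:
  "quotient_matrix A a w ** A a = A a ** quotient_matrix A a (a # w)"
proof -
  let ?P = "word_prod A (replicate (length w) a)"
  have "?P ** (A a ** quotient_matrix A a (a # w)) = word_prod A (a # w)"
    using power_quotient[of "a # w"] by (simp add: matrix_mul_assoc)
  also have "\<dots> = ?P ** (quotient_matrix A a w ** A a)"
    by (simp add: matrix_mul_assoc power_quotient)
  finally have "matrix_inv ?P ** (?P ** (A a ** quotient_matrix A a (a # w))) =
      matrix_inv ?P ** (?P ** (quotient_matrix A a w ** A a))"
    by simp
  then show ?thesis
    by (simp add: matrix_mul_assoc matrix_inv_mult[OF invertible_power])
qed

text \<open>Take V k of greatest dimension. The n-th power of A a then maps V k onto V (k + n), and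
  a word of length n maps V k into V (k + n), so undoing the power returns to V k.\<close>

lemma invariant_of_nonspanning:
  assumes u: "u \<noteq> 0" and ns: "\<And>k. span ((\<lambda>K. word_prod A K *v u) ` words l k) \<noteq> UNIV"
  obtains U where "invariant (quotient_matrix A a ` language l) U" "U \<noteq> {0}" "U \<noteq> UNIV"
proof -
  define V where "V k = span ((\<lambda>K. word_prod A K *v u) ` words l k)" for k
  have V: "word_prod A w *v x \<in> V (k + n)" if w: "w \<in> words l n" and x: "x \<in> V k" for w n k x
  proof -
    have "(*v) (word_prod A w) ` ((\<lambda>K. word_prod A K *v u) ` words l k)
        \<subseteq> (\<lambda>K. word_prod A K *v u) ` words l (k + n)"
    proof clarify
      fix K assume "K \<in> words l k"
      then have "K @ w \<in> words l (k + n)" using w by (auto simp: words_def)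
      moreover have "word_prod A w *v (word_prod A K *v u) = word_prod A (K @ w) *v u"
        by (simp add: word_prod_append matrix_vector_mul_assoc)
      ultimately show "word_prod A w *v (word_prod A K *v u) \<in> (\<lambda>K. word_prod A K *v u) ` words l (k + n)"
        by blast
    qed
    then have "(*v) (word_prod A w) ` V k \<subseteq> V (k + n)"
      unfolding V_def by (simp add: span_mono flip: linear_span_image)
    then show ?thesis using x by blast
  qed
  have one: "replicate n a \<in> words l n" for n
    using a by (auto simp: words_def)
  have dim_mono: "dim (V k) \<le> dim (V (k + n))" for k n
  proof -
    have "dim (V k) = dim ((*v) (word_prod A (replicate n a)) ` V k)"
      by (simp add: dim_image_invertible invertible_power)
    also have "\<dots> \<le> dim (V (k + n))"
      using V[OF one] by (intro dim_subset) auto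
    finally show ?thesis .
  qed
  have "\<exists>k. True \<and> (\<forall>n. True \<longrightarrow> dim (V n) \<le> dim (V k))"
    using dim_subset_UNIV[where 'a = "real^'d"] by (intro ex_has_greatest_nat[where b = "Suc CARD('d)"]) (auto intro: le_imp_less_Suc)
  then obtain k where k: "\<And>n. dim (V n) \<le> dim (V k)"
    by blast
  have "invariant (quotient_matrix A a ` language l) (V k)"
    unfolding invariant_def
  proof (intro conjI ballI, goal_cases)
    case 1
    then show ?case by (simp add: V_def)
  next
    case (2 g x)
    then obtain w where w: "w \<in> words l (length w)" "g = quotient_matrix A a w"
      by (auto simp: language_def words_def)
    let ?P = "word_prod A (replicate (length w) a)"
    have "(*v) ?P ` V k = V (k + length w)"
    proof (rule subspace_dim_equal)
      show "(*v) ?P ` V k \<subseteq> V (k + length w)"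
        using V[OF one] by auto
      show "dim (V (k + length w)) \<le> dim ((*v) ?P ` V k)"
        using k by (simp add: dim_image_invertible invertible_power)
      show "subspace ((*v) ?P ` V k)"
        by (intro linear_subspace_image) (auto simp: V_def)
    qed (simp add: V_def)
    then obtain y where y: "y \<in> V k" "?P *v y = word_prod A w *v x"
      using V[OF w(1) 2(2)] by (metis imageE)
    then have "?P *v y = ?P *v (g *v x)"
      by (simp add: w(2) power_quotient_vec)
    then have "y = g *v x"
      by (rule injD[OF invertible_inj[OF invertible_power]])
    then show ?case using y by simp
  qed
  moreover have "V k \<noteq> UNIV" using ns by (simp add: V_def)
  moreover have "V k \<noteq> {0}"
  proof
    assume "V k = {0}"
    then have "word_prod A (replicate k a) *v u = 0"
      using span_base[of "word_prod A (replicate k a) *v u" "(\<lambda>K. word_prod A K *v u) ` words l k"] one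
      by (auto simp: V_def)
    then show False
      using injD[OF invertible_inj[OF invertible_power], of k u 0] u by simp
  qed
  ultimately show thesis by (intro that)
qed

lemma proportional_of_invariant:
  assumes irr: "\<And>t. 0 < t \<Longrightarrow> t dvd CARD('d) \<Longrightarrow>
           irreducible_family UNIV {(*v) (word_prod A w) | w. w \<in> words l t}"
    and ext: "\<And>m. 1 \<le> m \<Longrightarrow> m \<le> CARD('d) - 1 \<Longrightarrow>
           irreducible_family (exterior_power m :: (real^('d set)) set)
             {exterior_map m (A i) | i. i \<in> {1..l}}"
    and U: "invariant (quotient_matrix A a ` language l) U" "U \<noteq> {0}" "U \<noteq> UNIV"
    and i: "i \<in> {1..l}"
  obtains c where "A i = c *\<^sub>R A a"
proof -
  let ?\<Gamma> = "quotient_matrix A a ` language l"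
  obtain W0 where W0: "minimal_invariant ?\<Gamma> W0" "dim W0 \<le> dim U"
    using minimal_invariant_exists[OF U(1,2)] by blast
  have "span U = U"
    using U(1) by (intro span_eq_iff[THEN iffD2]) (simp add: invariant_def)
  moreover have "dim U = CARD('d) \<longleftrightarrow> span U = UNIV"
    using dim_eq_full[of U] by simp
  ultimately have "dim U \<noteq> CARD('d)"
    using U(3) by metis
  then have dim_less: "dim W0 < CARD('d)"
    using W0(2) dim_subset_UNIV[of U] by simp
  have "dim W0 \<noteq> 0"
    using minimal_invariantD[OF W0(1)] subspace_0 by (auto simp: dim_eq_0)
  then have dim_ge: "1 \<le> dim W0" by linarith
  define W where "W k = (((*v) (A a)) ^^ k) ` W0" for k
  have W_0: "W 0 = W0" and W_Suc: "W (Suc k) = (*v) (A a) ` W k" for k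
    by (auto simp: W_def image_image)
  have conj: "\<exists>h\<in>?\<Gamma>. g ** A a = A a ** h" if g: "g \<in> ?\<Gamma>" for g
  proof -
    obtain w where w: "w \<in> language l" "g = quotient_matrix A a w" using g by blast
    have "a # w \<in> language l" using w(1) a by (auto simp: language_def words_def)
    then show ?thesis using w(2) quotient_matrix_commute by blast
  qed
  have minW: "minimal_invariant ?\<Gamma> (W k)" for k
    by (induction k) (auto simp: W_0 W0 W_Suc intro: minimal_invariant_image[OF inv[OF a] conj])
  have dimW: "dim (W k) = dim W0" for k
    by (induction k) (auto simp: W_0 W_Suc dim_image_invertible[OF inv[OF a]])
  have word_W: "word_prod A w *v x \<in> W (k + n)" if w: "w \<in> words l n" and x: "x \<in> W k" for w n k x
  proof -
    have n: "n = length w" "w \<in> language l" using w by (auto simp: words_def language_def)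
    let ?y = "quotient_matrix A a w *v x"
    have "?y \<in> W k"
      using minimal_invariantD(1)[OF minW] n(2) x by (auto simp: invariant_def)
    then have "(((*v) (A a)) ^^ n) ?y \<in> W (k + n)"
      by (auto simp: W_def funpow_add add.commute[of k n])
    then show ?thesis
      using power_quotient_vec[of w x] by (simp add: word_prod_replicate n(1))
  qed
  \<comment> \<open>A word of length q maps W (k q) into W ((k + 1) q), so the span is invariant
    under the q-th power of the cocycle.\<close>
  have span_W: "span (\<Union>k. W (k * q)) = UNIV" if q: "0 < q" "q dvd CARD('d)" for q
  proof (rule irreducible_familyD[OF irr[OF q]])
    have "W 0 \<subseteq> (\<Union>k. W (k * q))" by (metis UNIV_I UN_upper mult_0)
    then have "W 0 \<subseteq> span (\<Union>k. W (k * q))" by (meson order_trans span_superset)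
    then show "span (\<Union>k. W (k * q)) \<noteq> {0}"
      using minimal_invariantD(2,3)[OF W0(1)] subspace_0 by (auto simp: W_0)
    fix f assume "f \<in> {(*v) (word_prod A w) | w. w \<in> words l q}"
    then obtain w where w: "w \<in> words l q" "f = (*v) (word_prod A w)" by blast
    have "f ` (\<Union>k. W (k * q)) \<subseteq> (\<Union>k. W (k * q))"
    proof clarify
      fix x k assume "x \<in> W (k * q)"
      then have "f x \<in> W (Suc k * q)"
        using word_W[OF w(1)] w(2) by (metis add.commute mult_Suc)
      then show "f x \<in> (\<Union>k. W (k * q))" by blast
    qed
    then show "f ` span (\<Union>k. W (k * q)) \<subseteq> span (\<Union>k. W (k * q))"
      unfolding w(2) by (simp add: span_mono flip: linear_span_image)
  qed simp
  have emb: "embeds ?\<Gamma> (W k) (W 0)" for k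
    using cyclic_embeds[of "A a" ?\<Gamma> W k] inv[OF a] conj minW W_Suc span_W by blast
  have F: "(*v) f ` W k \<subseteq> W (Suc k)" if "f \<in> A ` {1..l}" for f k
  proof -
    obtain j where j: "j \<in> {1..l}" "f = A j" using \<open>f \<in> A ` {1..l}\<close> by blast
    then have "[j] \<in> words l 1" by (simp add: words_def)
    then show ?thesis using word_W[of "[j]" 1] j(2) by auto
  qed
  have "exterior_map (dim W0) ` A ` {1..l} = {exterior_map (dim W0) (A i) | i. i \<in> {1..l}}"
    by auto
  then have irr_ext: "irreducible_family (exterior_power (dim W0) :: (real^('d set)) set)
      (exterior_map (dim W0) ` A ` {1..l})"
    using ext[of "dim W0"] dim_ge dim_less by simp
  let ?g = "quotient_matrix A a [i]"
  have g: "?g \<in> ?\<Gamma>" using i by (intro imageI) (auto simp: language_def words_def)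
  obtain c where c: "\<And>v. wedge (dim W0) (\<lambda>j. ?g *v v j) = c *\<^sub>R wedge (dim W0) v"
    using exterior_map_scalar[OF minimal_invariantD(1)[OF minW] dimW emb F irr_ext g] by blast
  \<comment> \<open>Once the quotient for the one-letter word [i] is scalar, this factorisation
    makes A i a multiple of A a.\<close>
  have Ai: "A i = A a ** ?g"
    using power_quotient[of "[i]"] by simp
  have "invertible ?g"
  proof -
    have "invertible (matrix_inv (A a))"
      using matrix_inv_mult[OF inv[OF a]] by (auto simp: invertible_def)
    then show ?thesis
      using invertible_mult[OF _ inv[OF i]] by (simp add: quotient_matrix_def)
  qed
  then obtain k where k: "\<And>x. ?g *v x = k *\<^sub>R x"
    using exterior_scalar_imp_scalar[OF dim_ge dim_less _ c] by blast
  have "A i *v x = (k *\<^sub>R A a) *v x" for x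
    unfolding Ai
    by (simp add: k matrix_vector_mult_scaleR scaleR_matrix_vector_assoc flip: matrix_vector_mul_assoc)
  then show thesis by (intro that[of k]) (simp add: matrix_eq)
qed

end

text \<open>Proportional generators commute, so every word product lies in their commutant, where
  norms are multiplicative up to a constant. The connecting word is always [a].\<close>

lemma proportional_imp_quasi_multiplicative:
  fixes A :: "nat \<Rightarrow> real^'d^'d"
  assumes a: "a \<in> {1..l}" and inv: "\<And>i. i \<in> {1..l} \<Longrightarrow> invertible (A i)"
    and irr: "irreducible_family UNIV ((*v) ` A ` {1..l})"
    and scal: "\<And>i. i \<in> {1..l} \<Longrightarrow> \<exists>c. A i = c *\<^sub>R A a"
  shows "quasi_multiplicative l A 1"
proof -
  have comm: "A i ** A j = A j ** A i" if ij: "i \<in> {1..l}" "j \<in> {1..l}" for i j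
  proof -
    obtain b c where "A i = b *\<^sub>R A a" "A j = c *\<^sub>R A a" using scal[OF ij(1)] scal[OF ij(2)] by blast
    then show ?thesis
      by (simp add: matrix_eq scaleR_matrix_vector_assoc matrix_vector_mult_scaleR
          flip: matrix_vector_mul_assoc scaleR_matrix_vector_assoc)
  qed
  have word_comm: "word_prod A w ** B = B ** word_prod A w" if w: "w \<in> language l" and B: "B \<in> A ` {1..l}" for w B
  proof -
    have "set w \<subseteq> {1..l}" using w by (auto simp: language_def words_def)
    then show ?thesis
    proof (induction w)
      case (Cons i w)
      have "A i ** B = B ** A i" using comm B Cons.prems by auto
      then have "word_prod A w ** A i ** B = word_prod A w ** B ** A i"
        by (metis matrix_mul_assoc)
      then show ?case using Cons by (simp add: matrix_mul_assoc)
    qed simp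
  qed
  obtain c where c: "c > 0"
    "\<And>X Y. (\<And>B. B \<in> A ` {1..l} \<Longrightarrow> X ** B = B ** X) \<Longrightarrow> (\<And>B. B \<in> A ` {1..l} \<Longrightarrow> Y ** B = B ** Y) \<Longrightarrow>
       c * onorm ((*v) X) * onorm ((*v) Y) \<le> onorm ((*v) (X ** Y))"
    using commutant_onorm_mult[OF irr] by blast
  define n where "n = onorm ((*v) (A a))"
  have one: "[a] \<in> words l 1" "a \<in> {1..l}" using a by (auto simp: words_def)
  have "A a \<noteq> 0"
  proof
    assume "A a = 0"
    then have "(0 :: real^'d^'d) = mat 1"
      using inv[OF one(2)] by (auto simp: invertible_def)
    then show False
      using matrix_vector_mul_lid[of "axis undefined 1 :: real^'d"] by (metis matrix_vector_mult_0 axis_eq_0_iff zero_neq_one)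
  qed
  then have n: "n > 0"
    unfolding n_def by (subst onorm_pos_lt) (auto simp: matrix_eq)
  show ?thesis
    unfolding quasi_multiplicative_def
  \<comment> \<open>Splitting a product of three matrices uses the constant c twice; n is the norm
    of the middle factor A a.\<close>
  proof (intro exI[of _ "c * c * n"] conjI ballI)
    show "0 < c * c * n" using c n by simp
    fix I J assume IJ: "I \<in> language l" "J \<in> language l"
    let ?I = "onorm ((*v) (word_prod A I))" and ?J = "onorm ((*v) (word_prod A J))"
    have "c * n * ?I \<le> onorm ((*v) (A a ** word_prod A I))"
      unfolding n_def using comm one(2) word_comm[OF IJ(1)] by (intro c(2)) blast+
    then have "(c * ?J) * (c * n * ?I) \<le> (c * ?J) * onorm ((*v) (A a ** word_prod A I))"
      using c(1) by (intro mult_left_mono) (auto simp: onorm_pos_le)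
    also have "\<dots> \<le> onorm ((*v) (word_prod A J ** (A a ** word_prod A I)))"
    proof (rule c(2))
      fix B assume B: "B \<in> A ` {1..l}"
      show "word_prod A J ** B = B ** word_prod A J"
        by (rule word_comm[OF IJ(2) B])
      have "A a ** B = B ** A a" using comm one B by auto
      then show "A a ** word_prod A I ** B = B ** (A a ** word_prod A I)"
        using word_comm[OF IJ(1) B] by (metis matrix_mul_assoc)
    qed
    finally have "c * c * n * ?I * ?J \<le> onorm ((*v) (word_prod A (I @ [a] @ J)))"
      by (simp add: word_prod_append matrix_mul_assoc mult_ac)
    then show "\<exists>K\<in>words l 1. c * c * n * ?I * ?J \<le> onorm ((*v) (word_prod A (I @ K @ J)))"
      using one by blast
  qed
qed

theorem corollary1p2:
  fixes l :: nat and A :: "nat \<Rightarrow> real^'d^'d"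
  assumes "1 \<le> l"
    and "\<And>i. i \<in> {1..l} \<Longrightarrow> invertible (A i)"
    and "\<And>t. 0 < t \<Longrightarrow> t dvd CARD('d) \<Longrightarrow>
           irreducible_family UNIV {(*v) (word_prod A w) | w. w \<in> words l t}"
    and "\<And>m. 1 \<le> m \<Longrightarrow> m \<le> CARD('d) - 1 \<Longrightarrow>
           irreducible_family (exterior_power m :: (real^('d set)) set)
             {exterior_map m (A i) | i. i \<in> {1..l}}"
  shows "\<exists>k\<ge>1. quasi_multiplicative l A k"
proof (cases "\<exists>k\<ge>1. \<forall>u. u \<noteq> 0 \<longrightarrow> span ((\<lambda>K. word_prod A K *v u) ` words l k) = UNIV")
  case True
  then show ?thesis using spanning_imp_quasi_multiplicative by metis
next
  case False
  have one: "1 \<in> {1..l}" using assms(1) by simp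
  have "\<And>k. 1 \<le> k \<Longrightarrow> \<exists>u. u \<noteq> 0 \<and> span ((\<lambda>K. word_prod A K *v u) ` words l k) \<noteq> UNIV"
    using False by auto
  from common_nonspanning_vector[OF assms(1,2) this]
  obtain u where u: "u \<noteq> 0" "\<And>k. span ((\<lambda>K. word_prod A K *v u) ` words l k) \<noteq> UNIV"
    by blast
  from invariant_of_nonspanning[OF one assms(2) u]
  obtain U where U: "invariant (quotient_matrix A 1 ` language l) U" "U \<noteq> {0}" "U \<noteq> UNIV"
    by blast
  have scal: "\<exists>c. A i = c *\<^sub>R A 1" if "i \<in> {1..l}" for i
    using proportional_of_invariant[OF one assms(2-4) U that] by blast
  \<comment> \<open>Words of length 1 are the letters, so the case t = 1 of the hypothesis is
    irreducibility of the generators themselves.\<close>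
  have "words l 1 = (\<lambda>i. [i]) ` {1..l}"
    by (auto simp: words_def length_Suc_conv)
  then have "{(*v) (word_prod A w) | w. w \<in> words l 1} = (*v) ` A ` {1..l}"
    by force
  then have "irreducible_family UNIV ((*v) ` A ` {1..l})"
    using assms(3)[of 1] by simp
  from proportional_imp_quasi_multiplicative[OF one assms(2) this scal]
  have "quasi_multiplicative l A 1" .
  then show ?thesis by blast
qed

end
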